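(* Let $P$ be a poset in the class $\mathcal{B}$ (defined in the context; every such $P$ is graded with $\alpha(G_P)=0$ and $e(P)=\frac12(|P|+h(P)-2)$), and let $P'$ be a poset obtained from $P$ by performing one $\Lambda$-extension or one $V$-extension at some level. Then \[ e(P')=\frac12\bigl(|P'|+h(P')-\alpha(G_{P'})-2\bigr), \] and consequently $\lim_{n\to\infty}\mathrm{La}(n,P')/\binom{n}{\lfloor n/2\rfloor}$ exists and equals $e(P')$.
   Context: All posets are finite and connected. A poset $Q$ contains a poset $P$ as a (weak) subposet if there is an injection $f:P\to Q$ such that $a\le_P b$ implies $f(a)\le_Q f(b)$; otherwise $Q$ is $P$-free. $B_n=(2^{[n]},\subseteq)$ is the Boolean lattice, and $\mathrm{La}(n,P)$ is the largest size of a $P$-free family $F\subseteq 2^{[n]}$ (ordered by inclusion). A level of $B_n$ is the collection of all subsets of $[n]$ of a given size. $e(P)$ is the maximum $m$ such that, in every Boolean lattice, the union of any $m$ consecutive levels does not contain $P$ as a subposet. The height $h(P)$ is the largest size of a chain in $P$. $P$ is graded if every maximal chain has exactly $h=h(P)$ elements. Its levels $L_1,\dots,L_h$ are defined by: $L_1$ is the set of minimal elements of $P$, and $L_i$ is the set of minimal elements of $P\setminus\bigcup_{j<i}L_j$ for $i\ge2$. Auxiliary graph $G_P$ of a graded poset $P$: the vertices are the sets $\{x,y,z\}\subseteq P$ of three mutually incomparable elements of one of two types: $V$-type, if for some $i$ one has $x\in L_i$ and $y,z\in L_{i+1}$; $\Lambda$-type, if for some $i$ one has $x,y\in L_i$ and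 $z\in L_{i+1}$. Two distinct vertices $v,v'$ are adjacent if and only if either $v,v'\subset L_i\cup L_{i+1}$ for some $i$, or (up to exchanging the names $v$ and $v'$) $v\subset L_{i-1}\cup L_i$ and $v'\subset L_i\cup L_{i+1}$ for some $i$ and one of the following holds: (1) $|L_i|\ge5$ and $v\cap v'\ne\varnothing$; (2) $|L_i|\in\{3,4\}$ and $v\cap v'\neq\varnothing$, except in the case where $v$ is $V$-type, $v'$ is $\Lambda$-type and $|v\cap v'|=1$; (3) $|L_i|\in\{3,4\}$, $v\cap v'=\varnothing$ and $|v\cap L_i|+|v'\cap L_i|=|L_i|$; (4) $|L_i|=2$. $\alpha(G_P)$ is the maximum size of an independent set of $G_P$ ($0$ if $G_P$ has no vertices). Class $\mathcal{B}$ (posets constructed by Burcsi and Nagy). For positive integers $a_1,\dots,a_h$ let $K_{a_1,\dots,a_h}$ be the poset with levels of sizes $a_1,\dots,a_h$ (from bottom to top) in which every element of a lower level is less than every element of a higher level and elements of the same level are incomparable. $\mathcal{B}$ is the smallest class containing the one-element poset, $K_{2,2}$, $K_{1,3,1}$, $K_{2,3,2}$, $K_{1,4,2}$ and $K_{1,4,4,1}$ and closed under the operations: $P_1\oplus P_2$, obtained from the disjoint union of $P_1$ and $P_2$ by adding all relations $a<b$ with $a\in P_1$, $b\in P_2$; and, when $P_1$ has a greatest element and $P_2$ has a least element, $P_1\otimes P_2$, obtained by identifying the greatest element of $P_1$ with the least element of $P_2$ (and taking the transitive closure). Extensions. Let $P$ be graded of height $h$. A $\Lambda$-extension of $P$ at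 level $i$ ($2\le i\le h$), allowed only when $|L_{i-1}|\ge3$, adds a new element $x$ together with the relations that $x$ is less than every element of $L_{i+1}$ (no condition if $i=h$) and $x$ is greater than all but two elements of $L_{i-1}$ (and takes the transitive closure). A $V$-extension of $P$ at level $i$ ($1\le i\le h-1$), allowed only when $|L_{i+1}|\ge3$, adds a new element $x$ together with the relations that $x$ is greater than every element of $L_{i-1}$ (no condition if $i=1$) and $x$ is less than all but two elements of $L_{i+1}$ (and takes the transitive closure). The choice of the two omitted elements is arbitrary. *)

theory Defs
  imports Complex_Main "HOL-Library.Disjoint_Sets"
begin

text \<open>
  A finite poset is represented by its reflexive order relation \<open>r\<close>; its elements are \<open>Field r\<close>.
\<close>

definition contains_poset :: "'b rel \<Rightarrow> 'a rel \<Rightarrow> bool" where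
  "contains_poset q p \<longleftrightarrow>
     (\<exists>f. inj_on f (Field p) \<and> f ` Field p \<subseteq> Field q \<and> (\<forall>(a, b) \<in> p. (f a, f b) \<in> q))"

definition inclusion_order :: "'b set set \<Rightarrow> 'b set rel" where
  "inclusion_order \<F> = {(A, B). A \<in> \<F> \<and> B \<in> \<F> \<and> A \<subseteq> B}"

definition poset_free :: "'a rel \<Rightarrow> 'b set set \<Rightarrow> bool" where
  "poset_free p \<F> \<longleftrightarrow> \<not> contains_poset (inclusion_order \<F>) p"

definition La :: "nat \<Rightarrow> 'a rel \<Rightarrow> nat" where
  "La n p = Max {card \<F> |\<F>. \<F> \<subseteq> Pow {1..n} \<and> poset_free p \<F>}"

definition boolean_level :: "nat \<Rightarrow> nat \<Rightarrow> nat set set" where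
  "boolean_level n k = {A. A \<subseteq> {1..n} \<and> card A = k}"

text \<open>
  The condition \<open>k + m \<le> n + 1\<close> says that the levels \<open>k, \<dots>, k + m - 1\<close> all exist
  in the Boolean lattice on \<open>{1..n}\<close>.
\<close>

definition poset_e :: "'a rel \<Rightarrow> nat" where
  "poset_e p = Max {m. \<forall>n k. k + m \<le> n + 1 \<longrightarrow> poset_free p (\<Union>i\<in>{k..<k + m}. boolean_level n i)}"

definition height :: "'a rel \<Rightarrow> nat" where
  "height p = Max (card ` Chains p)"

definition minimal_elements :: "'a rel \<Rightarrow> 'a set \<Rightarrow> 'a set" where
  "minimal_elements p A = {x \<in> A. \<forall>y \<in> A. (y, x) \<in> p \<longrightarrow> y = x}"

text \<open>
  Levels are numbered from 1. Outside \<open>1, \<dots>, height p\<close> they are empty, so that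
  conditions on a level below the bottom or above the top one are vacuous.
\<close>

fun level :: "'a rel \<Rightarrow> nat \<Rightarrow> 'a set" where
  "level p i = (if i = 0 then {} else minimal_elements p (Field p - (\<Union>j<i. level p j)))"

declare level.simps [simp del]

definition incomparable :: "'a rel \<Rightarrow> 'a \<Rightarrow> 'a \<Rightarrow> bool" where
  "incomparable p x y \<longleftrightarrow> (x, y) \<notin> p \<and> (y, x) \<notin> p"

definition V_type :: "'a rel \<Rightarrow> 'a set \<Rightarrow> bool" where
  "V_type p v \<longleftrightarrow> (\<exists>x y z i. v = {x, y, z} \<and>
     incomparable p x y \<and> incomparable p x z \<and> incomparable p y z \<and>
     x \<in> level p i \<and> y \<in> level p (i + 1) \<and> z \<in> level p (i + 1))"

definition Lambda_type :: "'a rel \<Rightarrow> 'a set \<Rightarrow> bool" where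
  "Lambda_type p v \<longleftrightarrow> (\<exists>x y z i. v = {x, y, z} \<and>
     incomparable p x y \<and> incomparable p x z \<and> incomparable p y z \<and>
     x \<in> level p i \<and> y \<in> level p i \<and> z \<in> level p (i + 1))"

definition aux_vertices :: "'a rel \<Rightarrow> 'a set set" where
  "aux_vertices p = {v. V_type p v \<or> Lambda_type p v}"

text \<open>The index \<open>i\<close> is the common level: \<open>v\<close> lies in the levels \<open>i - 1, i\<close> and \<open>w\<close> in \<open>i, i + 1\<close>.\<close>

definition consecutive_adj :: "'a rel \<Rightarrow> nat \<Rightarrow> 'a set \<Rightarrow> 'a set \<Rightarrow> bool" where
  "consecutive_adj p i v w \<longleftrightarrow>
     v \<subseteq> level p (i - 1) \<union> level p i \<and> w \<subseteq> level p i \<union> level p (i + 1) \<and>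
     (card (level p i) \<ge> 5 \<and> v \<inter> w \<noteq> {} \<or>
      card (level p i) \<in> {3, 4} \<and> v \<inter> w \<noteq> {} \<and>
        \<not> (V_type p v \<and> Lambda_type p w \<and> card (v \<inter> w) = 1) \<or>
      card (level p i) \<in> {3, 4} \<and> v \<inter> w = {} \<and>
        card (v \<inter> level p i) + card (w \<inter> level p i) = card (level p i) \<or>
      card (level p i) = 2)"

definition aux_adj :: "'a rel \<Rightarrow> 'a set \<Rightarrow> 'a set \<Rightarrow> bool" where
  "aux_adj p v w \<longleftrightarrow> v \<in> aux_vertices p \<and> w \<in> aux_vertices p \<and> v \<noteq> w \<and>
     ((\<exists>i. v \<subseteq> level p i \<union> level p (i + 1) \<and> w \<subseteq> level p i \<union> level p (i + 1)) \<or>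
      (\<exists>i\<ge>1. consecutive_adj p i v w \<or> consecutive_adj p i w v))"

definition aux_alpha :: "'a rel \<Rightarrow> nat" where
  "aux_alpha p =
     Max {card I |I. I \<subseteq> aux_vertices p \<and> (\<forall>v\<in>I. \<forall>w\<in>I. \<not> aux_adj p v w)}"

text \<open>\<open>complete_multilevel as p\<close>: \<open>p\<close> is a copy of \<open>K\<close> with level sizes \<open>as\<close>, listed bottom to top.\<close>

definition complete_multilevel :: "nat list \<Rightarrow> 'a rel \<Rightarrow> bool" where
  "complete_multilevel as p \<longleftrightarrow> (\<exists>Ls. map card Ls = as \<and> (\<forall>A\<in>set Ls. finite A) \<and>
     disjoint_family_on (\<lambda>i. Ls ! i) {..<length Ls} \<and>
     p = Id_on (\<Union>(set Ls)) \<union> {(x, y). \<exists>i j. i < j \<and> j < length Ls \<and> x \<in> Ls ! i \<and> y \<in> Ls ! j})"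

text \<open>
  The class is closed under isomorphism. The two operations are expressed on carriers that are
  disjoint, respectively share exactly the identified element.
\<close>

inductive burcsi_nagy :: "'a rel \<Rightarrow> bool" where
  single: "burcsi_nagy {(a, a)}"
| base: "complete_multilevel as p \<Longrightarrow>
    as \<in> {[2, 2], [1, 3, 1], [2, 3, 2], [1, 4, 2], [1, 4, 4, 1]} \<Longrightarrow> burcsi_nagy p"
| oplus: "burcsi_nagy p \<Longrightarrow> burcsi_nagy q \<Longrightarrow> Field p \<inter> Field q = {} \<Longrightarrow>
    burcsi_nagy (p \<union> q \<union> Field p \<times> Field q)"
| otimes: "burcsi_nagy p \<Longrightarrow> burcsi_nagy q \<Longrightarrow> Field p \<inter> Field q = {t} \<Longrightarrow>
    (\<forall>x\<in>Field p. (x, t) \<in> p) \<Longrightarrow> (\<forall>y\<in>Field q. (t, y) \<in> q) \<Longrightarrow>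
    burcsi_nagy ((p \<union> q)\<^sup>+)"

definition Lambda_extension :: "'a rel \<Rightarrow> nat \<Rightarrow> 'a rel \<Rightarrow> bool" where
  "Lambda_extension p i p' \<longleftrightarrow> 2 \<le> i \<and> i \<le> height p \<and> 3 \<le> card (level p (i - 1)) \<and>
     (\<exists>x a b. x \<notin> Field p \<and> a \<in> level p (i - 1) \<and> b \<in> level p (i - 1) \<and> a \<noteq> b \<and>
        p' = (p \<union> {(x, x)} \<union> {x} \<times> level p (i + 1) \<union> (level p (i - 1) - {a, b}) \<times> {x})\<^sup>+)"

definition V_extension :: "'a rel \<Rightarrow> nat \<Rightarrow> 'a rel \<Rightarrow> bool" where
  "V_extension p i p' \<longleftrightarrow> 1 \<le> i \<and> i + 1 \<le> height p \<and> 3 \<le> card (level p (i + 1)) \<and>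
     (\<exists>x a b. x \<notin> Field p \<and> a \<in> level p (i + 1) \<and> b \<in> level p (i + 1) \<and> a \<noteq> b \<and>
        p' = (p \<union> {(x, x)} \<union> level p (i - 1) \<times> {x} \<union> {x} \<times> (level p (i + 1) - {a, b}))\<^sup>+)"

end

theory Submission
  imports Defs "HOL-Combinatorics.Permutations"
begin

text \<open>
  Posets of the class \<open>\<B>\<close> are complete multilevel posets, and with \<open>m = (card P + h(P) - 2) / 2\<close> each
  copy of them in a Boolean lattice has two members whose sizes differ by at least \<open>m\<close>
  (\<open>burcsi_nagy_layered\<close>). Hence \<open>m\<close> consecutive levels contain neither \<open>P\<close> nor the larger poset \<open>P'\<close>,
  and the \<open>m\<close> middle levels show that \<open>La n P'\<close> is at least about \<open>m\<close> times the central binomial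
  coefficient.

  For the upper bound, consider the double chain of Burcsi and Nagy: the sets \<open>A\<^sub>i = {1..i}\<close> and
  \<open>B\<^sub>i = {1..i-1} \<union> {i+1}\<close>, two in each level. Given sufficiently many of its sets, one can embed a multilevel
  poset greedily, level after level, losing at most one set between two consecutive levels. This gives
  \<open>2 m + 1\<close> as the number of sets that force \<open>P\<close>. The point is that the same number forces \<open>P'\<close>: the
  set that would be lost between two levels is incomparable to at most two sets of the neighbouring
  level, so that it can play the part of the new element \<open>x\<close> (\<open>lower_split\<close>, \<open>upper_split\<close>,
  \<open>extension_embedding\<close>). Averaging over all permutations of the ground set turns this into the bound
  \<open>m\<close> times the central binomial coefficient for families free of \<open>P'\<close>, up to the two trivial sets
  (\<open>card_family_le\<close>). The unpermuted double chain shows that \<open>m + 1\<close> levels in a large Boolean lattice do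
  contain \<open>P'\<close>, so \<open>e(P') = m\<close>.

  Finally, the three mutually incomparable elements on consecutive levels of \<open>P'\<close> are \<open>x\<close> and the two elements
  omitted by the extension (\<open>aux_vertices_E\<close>). The auxiliary graph is a single vertex,
  \<open>\<alpha>(G\<^bsub>P'\<^esub>) = 1\<close>, and since the extension adds one element and no height, the formula evaluates to \<open>m\<close>.
\<close>

section \<open>Layered orders\<close>

text \<open>
  The poset with levels \<open>{x \<in> A. rk x = i}\<close> in which every element of a lower level lies below
  every element of a higher one: up to isomorphism the posets \<open>K\<close> with prescribed level sizes.
\<close>

definition layered :: "'a set \<Rightarrow> ('a \<Rightarrow> nat) \<Rightarrow> 'a rel" where
  "layered A rk = {(x, y). x \<in> A \<and> y \<in> A \<and> (x = y \<or> rk x < rk y)}"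

lemma Field_layered [simp]: "Field (layered A rk) = A"
  by (auto simp: layered_def Field_def)

lemma trans_layered: "trans (layered A rk)"
  by (auto simp: layered_def trans_def)

text \<open>
  The level decomposition peels off minimal elements, so any function that increases along the order
  and drops by exactly one at some predecessor must coincide with the level index. The same
  predecessors, followed downwards, build a chain through all levels.
\<close>

locale ranked_poset =
  fixes p :: "'a rel" and rk :: "'a \<Rightarrow> nat" and h :: nat
  assumes finite_Field: "finite (Field p)"
    and range_rk: "rk ` Field p = {1..h}"
    and refl: "x \<in> Field p \<Longrightarrow> (x, x) \<in> p"
    and trans: "trans p"
    and increasing: "(x, y) \<in> p \<Longrightarrow> x = y \<or> rk x < rk y"
    and predecessor: "x \<in> Field p \<Longrightarrow> 1 < rk x \<Longrightarrow> \<exists>y. (y, x) \<in> p \<and> Suc (rk y) = rk x"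
begin

lemma level_eq: "level p i = {x \<in> Field p. rk x = i}"
proof (induction i rule: less_induct)
  case (less i)
  show ?case
  proof (cases "i = 0")
    case True
    have "rk x \<noteq> 0" if "x \<in> Field p" for x
      using range_rk that by force
    then show ?thesis using True by (auto simp: level.simps)
  next
    case False
    have rest: "Field p - (\<Union>j<i. level p j) = {x \<in> Field p. i \<le> rk x}"
      using less by auto
    have "minimal_elements p {x \<in> Field p. i \<le> rk x} = {x \<in> Field p. rk x = i}" (is "?M = ?L")
    proof
      show "?M \<subseteq> ?L"
      proof
        fix x assume x: "x \<in> ?M"
        then have xF: "x \<in> Field p" and ge: "i \<le> rk x"
          and min: "\<And>y. y \<in> Field p \<Longrightarrow> i \<le> rk y \<Longrightarrow> (y, x) \<in> p \<Longrightarrow> y = x"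
          by (auto simp: minimal_elements_def)
        have "rk x = i"
        proof (rule ccontr)
          assume "rk x \<noteq> i"
          then have gt: "i < rk x" using ge by simp
          then obtain y where y: "(y, x) \<in> p" "Suc (rk y) = rk x"
            using predecessor[OF xF] False by auto
          then have "y = x" using min[of y] gt by (auto simp: Field_def)
          then show False using y by simp
        qed
        then show "x \<in> ?L" using xF by simp
      qed
      show "?L \<subseteq> ?M"
        using increasing by (fastforce simp: minimal_elements_def)
    qed
    then show ?thesis using False rest by (subst level.simps) simp
  qed
qed

lemma chain_below:
  assumes "x \<in> Field p"
  shows "\<exists>C. C \<in> Chains p \<and> x \<in> C \<and> (\<forall>y\<in>C. (y, x) \<in> p) \<and> finite C \<and> card C = rk x"
  using assms
proof (induction "rk x" arbitrary: x)
  case 0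
  then show ?case using range_rk by force
next
  case (Suc n)
  show ?case
  proof (cases "n = 0")
    case True
    then show ?thesis using Suc refl by (intro exI[of _ "{x}"]) (auto simp: Chains_def)
  next
    case False
    then obtain y where y: "(y, x) \<in> p" "Suc (rk y) = rk x"
      using predecessor[OF Suc.prems] Suc.hyps by force
    have "y \<in> Field p" using y by (auto simp: Field_def)
    moreover have "n = rk y" using y Suc.hyps by simp
    ultimately obtain C where C: "C \<in> Chains p" "y \<in> C" "\<forall>z\<in>C. (z, y) \<in> p" "finite C" "card C = rk y"
      using Suc.hyps(1)[of y] by auto
    have below: "\<forall>z\<in>C. (z, x) \<in> p" using C(3) y(1) trans by (meson transD)
    have "x \<notin> C"
    proof
      assume "x \<in> C"
      then have "(x, y) \<in> p" using C by auto
      then have "x = y \<or> rk x < rk y" by (rule increasing)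
      then show False using y by auto
    qed
    then show ?thesis
      using C y below refl[OF Suc.prems]
      by (intro exI[of _ "insert x C"]) (auto simp: Chains_def)
  qed
qed

lemma height_eq:
  assumes "1 \<le> h"
  shows "height p = h"
  unfolding height_def
proof (rule Max_eqI)
  have sub: "Chains p \<subseteq> Pow (Field p)"
    by (auto simp: Chains_def Field_def)
  then show "finite (card ` Chains p)"
    using finite_Field by (meson finite_Pow_iff finite_imageI finite_subset)
  show "n \<le> h" if n: "n \<in> card ` Chains p" for n
  proof -
    obtain C where C: "C \<in> Chains p" "n = card C" using n by auto
    have CF: "C \<subseteq> Field p" using sub C by auto
    have "inj_on rk C"
      unfolding inj_on_def using C increasing by (fastforce simp: Chains_def)
    then have "card C = card (rk ` C)" by (simp add: card_image)
    also have "\<dots> \<le> card {1..h}" using CF range_rk by (intro card_mono) auto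
    finally show ?thesis using C by simp
  qed
  have "h \<in> rk ` Field p" using range_rk assms by auto
  then obtain x where "x \<in> Field p" "rk x = h" by auto
  then show "h \<in> card ` Chains p" using chain_below[of x] by force
qed

end

text \<open>Deleting pairs of consecutive ranks never destroys transitivity: a pair obtained by composing
  two strict relations skips at least one rank.\<close>

lemma trans_layered_minus:
  assumes "\<And>u v. (u, v) \<in> Q \<Longrightarrow> rk v = Suc (rk u)"
  shows "trans (layered A rk - Q)"
proof (rule transI)
  fix x y z assume xy: "(x, y) \<in> layered A rk - Q" and yz: "(y, z) \<in> layered A rk - Q"
  show "(x, z) \<in> layered A rk - Q"
  proof (cases "x = y \<or> y = z")
    case True
    then show ?thesis using xy yz by auto
  next
    case False
    then have "rk x < rk y" "rk y < rk z" "x \<in> A" "z \<in> A" using xy yz by (auto simp: layered_def)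
    moreover from this have "(x, z) \<notin> Q" using assms[of x z] by auto
    ultimately show ?thesis by (auto simp: layered_def)
  qed
qed

lemma Field_layered_minus:
  assumes "\<And>u v. (u, v) \<in> Q \<Longrightarrow> rk v = Suc (rk u)"
  shows "Field (layered A rk - Q) = A"
proof -
  have "(x, x) \<in> layered A rk - Q" if "x \<in> A" for x
    using that assms[of x x] by (auto simp: layered_def)
  then show ?thesis by (auto simp: Field_def layered_def)
qed

lemma ranked_layered_minus:
  assumes "finite A" and "rk ` A = {1..h}"
    and Q: "\<And>u v. (u, v) \<in> Q \<Longrightarrow> rk v = Suc (rk u)"
    and "\<And>x. x \<in> A \<Longrightarrow> 1 < rk x \<Longrightarrow> \<exists>y\<in>A. Suc (rk y) = rk x \<and> (y, x) \<notin> Q"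
  shows "ranked_poset (layered A rk - Q) rk h"
proof
  have F: "Field (layered A rk - Q) = A" using Q by (rule Field_layered_minus)
  show "finite (Field (layered A rk - Q))" "rk ` Field (layered A rk - Q) = {1..h}"
    by (simp_all only: F assms(1,2))
  show "trans (layered A rk - Q)" using Q by (rule trans_layered_minus)
  show "(x, x) \<in> layered A rk - Q" if "x \<in> Field (layered A rk - Q)" for x
    using that Q[of x x] F by (auto simp: layered_def)
  show "x = y \<or> rk x < rk y" if "(x, y) \<in> layered A rk - Q" for x y
    using that by (auto simp: layered_def)
  show "\<exists>y. (y, x) \<in> layered A rk - Q \<and> Suc (rk y) = rk x"
    if xF: "x \<in> Field (layered A rk - Q)" and gt: "1 < rk x" for x
  proof -
    have x: "x \<in> A" using xF F by simp
    obtain y where "y \<in> A" "Suc (rk y) = rk x" "(y, x) \<notin> Q"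
      using assms(4)[OF x gt] by blast
    then show ?thesis using x by (intro exI[of _ y]) (auto simp: layered_def)
  qed
qed

lemma ranked_layered:
  assumes "finite A" and "rk ` A = {1..h}"
  shows "ranked_poset (layered A rk) rk h"
proof -
  have "ranked_poset (layered A rk - {}) rk h"
  proof (rule ranked_layered_minus)
    show "\<exists>y\<in>A. Suc (rk y) = rk x \<and> (y, x) \<notin> {}" if "x \<in> A" "1 < rk x" for x
    proof -
      have "rk x \<le> h" using that assms by force
      then have "rk x - 1 \<in> rk ` A" using that assms by auto
      then show ?thesis using that by force
    qed
  qed (use assms in auto)
  then show ?thesis by simp
qed

section \<open>Embeddings of complete multilevel posets in Boolean lattices\<close>

definition boolean_embedding :: "'a rel \<Rightarrow> ('a \<Rightarrow> nat set) \<Rightarrow> bool" where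
  "boolean_embedding p f \<longleftrightarrow> inj_on f (Field p) \<and> (\<forall>x\<in>Field p. finite (f x)) \<and>
     (\<forall>(x, y)\<in>p. f x \<subseteq> f y)"

text \<open>
  No copy in a Boolean lattice fits into \<open>m\<close> consecutive levels, expressed by two witnesses because
  these can be linked when two posets are put on top of each other.
\<close>

definition spread_at_least :: "'a rel \<Rightarrow> nat \<Rightarrow> bool" where
  "spread_at_least p m \<longleftrightarrow> (\<forall>f. boolean_embedding p f \<longrightarrow>
     (\<exists>x\<in>Field p. \<exists>y\<in>Field p. card (f x) + m \<le> card (f y)))"

lemma boolean_embedding_mono:
  assumes "boolean_embedding q f" "p \<subseteq> q"
  shows "boolean_embedding p f"
proof -
  have "Field p \<subseteq> Field q" using assms(2) by (rule mono_Field)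
  moreover from this have "inj_on f (Field p)"
    using assms(1) unfolding boolean_embedding_def by (blast intro: inj_on_subset)
  ultimately show ?thesis using assms unfolding boolean_embedding_def by blast
qed

lemma boolean_embeddingD:
  assumes "boolean_embedding p f" "(x, y) \<in> p"
  shows "f x \<subseteq> f y" "finite (f y)" "x \<noteq> y \<Longrightarrow> f x \<subset> f y"
proof -
  have "x \<in> Field p" "y \<in> Field p" using assms(2) by (auto intro: FieldI1 FieldI2)
  then show "f x \<subseteq> f y" "finite (f y)" "x \<noteq> y \<Longrightarrow> f x \<subset> f y"
    using assms unfolding boolean_embedding_def inj_on_def by blast+
qed

text \<open>
  The sets between \<open>S\<close> and \<open>T\<close> form a Boolean lattice of dimension \<open>card T - card S\<close>. The three
  variants that follow exclude one or both end points, which is the case when an image of a level is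
  squeezed between images of single elements.
\<close>

lemma card_interval_le:
  fixes S T :: "'b set"
  assumes "finite T" "\<And>Y. Y \<in> \<Y> \<Longrightarrow> S \<subseteq> Y \<and> Y \<subseteq> T"
  shows "card \<Y> \<le> 2 ^ (card T - card S)"
proof (cases "\<Y> = {}")
  case False
  then have ST: "S \<subseteq> T" using assms by blast
  have "inj_on (\<lambda>Y. Y - S) \<Y>" using assms(2) unfolding inj_on_def by blast
  moreover have "(\<lambda>Y. Y - S) ` \<Y> \<subseteq> Pow (T - S)" using assms(2) by blast
  ultimately have "card \<Y> \<le> card (Pow (T - S))"
    using assms(1) by (intro card_inj_on_le) auto
  also have "\<dots> = 2 ^ (card T - card S)"
    using assms(1) ST by (simp add: card_Pow card_Diff_subset finite_subset)
  finally show ?thesis .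
qed simp

lemma card_interval_above_le:
  fixes S T :: "'b set"
  assumes "finite T" "\<And>Y. Y \<in> \<Y> \<Longrightarrow> S \<subset> Y \<and> Y \<subseteq> T" "\<Y> \<noteq> {}"
  shows "card \<Y> + 1 \<le> 2 ^ (card T - card S)"
proof -
  have "finite \<Y>" using assms by (meson finite_Pow_iff finite_subset Pow_iff subsetI)
  moreover have "S \<notin> \<Y>" using assms by blast
  moreover have "card (insert S \<Y>) \<le> 2 ^ (card T - card S)"
    using assms by (intro card_interval_le) blast+
  ultimately show ?thesis by simp
qed

lemma card_interval_below_le:
  fixes S T :: "'b set"
  assumes "finite T" "\<And>Y. Y \<in> \<Y> \<Longrightarrow> S \<subseteq> Y \<and> Y \<subset> T" "\<Y> \<noteq> {}"
  shows "card \<Y> + 1 \<le> 2 ^ (card T - card S)"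
proof -
  have "finite \<Y>" using assms by (meson finite_Pow_iff finite_subset Pow_iff subsetI psubset_imp_subset)
  moreover have "T \<notin> \<Y>" using assms by blast
  moreover have "card (insert T \<Y>) \<le> 2 ^ (card T - card S)"
    using assms by (intro card_interval_le) blast+
  ultimately show ?thesis by simp
qed

lemma card_open_interval_le:
  fixes S T :: "'b set"
  assumes "finite T" "\<And>Y. Y \<in> \<Y> \<Longrightarrow> S \<subset> Y \<and> Y \<subset> T" "\<Y> \<noteq> {}"
  shows "card \<Y> + 2 \<le> 2 ^ (card T - card S)"
proof -
  have "finite \<Y>" using assms by (meson finite_Pow_iff finite_subset Pow_iff subsetI psubset_imp_subset)
  moreover have "T \<notin> \<Y>" using assms by blast
  moreover have "card (insert T \<Y>) + 1 \<le> 2 ^ (card T - card S)"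
    using assms by (intro card_interval_above_le) blast+
  ultimately show ?thesis by simp
qed

text \<open>
  Two distinct sets cannot both be equal to their union, so a level of size two costs one additional
  level of the Boolean lattice.
\<close>

lemma exists_below_union:
  fixes f :: "'a \<Rightarrow> 'b set"
  assumes "card L = 2" "inj_on f L" "\<And>x. x \<in> L \<Longrightarrow> finite (f x)"
  shows "\<exists>x\<in>L. card (f x) + 1 \<le> card (\<Union> (f ` L))"
proof -
  obtain x y where L: "L = {x, y}" "x \<noteq> y" using assms(1) by (auto simp: card_2_iff)
  have ne: "f x \<noteq> f y" using assms(2) L by (auto simp: inj_on_def)
  have fin: "finite (f x \<union> f y)" using assms(3) L by auto
  have "f x \<subset> f x \<union> f y \<or> f y \<subset> f x \<union> f y" using ne by blast
  then have "card (f x) < card (f x \<union> f y) \<or> card (f y) < card (f x \<union> f y)"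
    using psubset_card_mono[OF fin] by blast
  then show ?thesis using L by auto
qed

lemma exists_above_inter:
  fixes f :: "'a \<Rightarrow> 'b set"
  assumes "card L = 2" "inj_on f L" "\<And>x. x \<in> L \<Longrightarrow> finite (f x)"
  shows "\<exists>x\<in>L. card (\<Inter> (f ` L)) + 1 \<le> card (f x)"
proof -
  obtain x y where L: "L = {x, y}" "x \<noteq> y" using assms(1) by (auto simp: card_2_iff)
  have ne: "f x \<noteq> f y" using assms(2) L by (auto simp: inj_on_def)
  have "f x \<inter> f y \<subset> f x \<or> f x \<inter> f y \<subset> f y" using ne by blast
  then have "card (f x \<inter> f y) < card (f x) \<or> card (f x \<inter> f y) < card (f y)"
    using psubset_card_mono assms(3) L by blast
  then show ?thesis using L by auto
qed

lemma exponent_ge_2: "(3::nat) \<le> 2 ^ r \<Longrightarrow> 2 \<le> r"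
  by (cases r; cases "r - 1") auto

lemma exponent_ge_3: "(5::nat) \<le> 2 ^ r \<Longrightarrow> 3 \<le> r"
proof (rule ccontr)
  assume "(5::nat) \<le> 2 ^ r" "\<not> 3 \<le> r"
  then have "(2::nat) ^ r \<le> 2 ^ 2" by (intro power_increasing) auto
  then show False using \<open>5 \<le> 2 ^ r\<close> by simp
qed

text \<open>
  Positivity of the sizes makes the rank function onto; an empty level in the list would leave a gap.
\<close>

lemma complete_multilevel_rank:
  assumes "complete_multilevel as p" "0 \<notin> set as"
  obtains rk where "finite (Field p)" "rk ` Field p = {1..length as}" "p = layered (Field p) rk"
    "card (Field p) = sum_list as" "\<And>i. i < length as \<Longrightarrow> card {x \<in> Field p. rk x = Suc i} = as ! i"
proof -
  obtain Ls where Ls: "map card Ls = as" "\<forall>A\<in>set Ls. finite A"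
      "disjoint_family_on (\<lambda>i. Ls ! i) {..<length Ls}"
    and p: "p = Id_on (\<Union>(set Ls)) \<union>
      {(x, y). \<exists>i j. i < j \<and> j < length Ls \<and> x \<in> Ls ! i \<and> y \<in> Ls ! j}"
    using assms(1) unfolding complete_multilevel_def by blast
  define A where "A = \<Union>(set Ls)"
  define idx where "idx x = (THE i. i < length Ls \<and> x \<in> Ls ! i)" for x
  have len: "length Ls = length as" using Ls(1) by auto
  have uniq: "i = j" if "i < length Ls" "j < length Ls" "x \<in> Ls ! i" "x \<in> Ls ! j" for i j x
    using Ls(3) that unfolding disjoint_family_on_def by fastforce
  have idx: "idx x = i" if "i < length Ls" "x \<in> Ls ! i" for i x
    unfolding idx_def using that uniq by blast
  have A: "\<exists>i<length Ls. x \<in> Ls ! i" if "x \<in> A" for x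
    using that by (auto simp: A_def in_set_conv_nth)
  have memA: "x \<in> A" if "i < length Ls" "x \<in> Ls ! i" for i x
    using that by (auto simp: A_def)
  have F: "Field p = A"
  proof
    show "Field p \<subseteq> A"
      unfolding p Field_def A_def[symmetric] using memA by (auto dest: order.strict_trans)
    show "A \<subseteq> Field p" unfolding p Field_def A_def[symmetric] by auto
  qed
  have fibre: "{x \<in> A. Suc (idx x) = Suc i} = Ls ! i" if "i < length Ls" for i
    using that A idx memA by auto
  show thesis
  proof (rule that[of "\<lambda>x. Suc (idx x)"])
    show "finite (Field p)" using Ls(2) F by (auto simp: A_def)
    show "card {x \<in> Field p. Suc (idx x) = Suc i} = as ! i" if "i < length as" for i
      using fibre[of i] that F len Ls(1) by (metis nth_map)
    have ne: "Ls ! i \<noteq> {}" if "i < length Ls" for i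
      using assms(2) Ls(1) that by (metis card.empty nth_map nth_mem length_map)
    show "(\<lambda>x. Suc (idx x)) ` Field p = {1..length as}"
    proof
      show "(\<lambda>x. Suc (idx x)) ` Field p \<subseteq> {1..length as}"
        using A idx F len by force
      show "{1..length as} \<subseteq> (\<lambda>x. Suc (idx x)) ` Field p"
      proof
        fix k assume "k \<in> {1..length as}"
        then obtain i where i: "k = Suc i" "i < length Ls" using len by (cases k) auto
        then obtain x where "x \<in> Ls ! i" using ne by blast
        then show "k \<in> (\<lambda>x. Suc (idx x)) ` Field p" using i idx memA F by force
      qed
    qed
    show "p = layered (Field p) (\<lambda>x. Suc (idx x))"
    proof -
      have "(\<exists>i j. i < j \<and> j < length Ls \<and> x \<in> Ls ! i \<and> y \<in> Ls ! j) \<longleftrightarrow>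
          x \<in> A \<and> y \<in> A \<and> idx x < idx y" for x y
      proof
        assume "\<exists>i j. i < j \<and> j < length Ls \<and> x \<in> Ls ! i \<and> y \<in> Ls ! j"
        then obtain i j where "i < j" "j < length Ls" "x \<in> Ls ! i" "y \<in> Ls ! j" by blast
        then show "x \<in> A \<and> y \<in> A \<and> idx x < idx y"
          using idx[of i x] idx[of j y] memA[of i x] memA[of j y] by simp
      next
        assume "x \<in> A \<and> y \<in> A \<and> idx x < idx y"
        then show "\<exists>i j. i < j \<and> j < length Ls \<and> x \<in> Ls ! i \<and> y \<in> Ls ! j"
          using A idx by metis
      qed
      then show ?thesis unfolding F by (auto simp: p layered_def A_def[symmetric] Id_on_def)
    qed
    have "card A = (\<Sum>i<length Ls. card (Ls ! i))"
    proof -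
      have "A = (\<Union>i<length Ls. Ls ! i)" using A memA by blast
      then show ?thesis
        using card_UN_disjoint'[OF Ls(3)] Ls(2) by simp
    qed
    also have "\<dots> = sum_list as" using Ls(1) by (auto simp: sum_list_sum_nth atLeast0LessThan)
    finally show "card (Field p) = sum_list as" using F by simp
  qed
qed

text \<open>
  Each building block is squeezed between the union of its bottom level and the intersection of its
  top level. A level of size two at an end contributes one, and a middle level of three (four)
  elements forces an interval of dimension at least two (three, if an end point is excluded). In
  \<open>[1, 3, 1]\<close> both end points are excluded, so already three elements force dimension three. In
  \<open>[1, 4, 4, 1]\<close> the union of the second level lies in the intersection of the third, and each of
  the two halves forces dimension three.
\<close>

lemma spread_base:
  assumes "complete_multilevel as p"
    and as: "as \<in> {[2, 2], [1, 3, 1], [2, 3, 2], [1, 4, 2], [1, 4, 4, 1]}"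
    and m: "sum_list as + length as = 2 * m + 2"
  shows "spread_at_least p m"
  unfolding spread_at_least_def
proof (intro allI impI)
  fix f assume f: "boolean_embedding p f"
  have "0 \<notin> set as" using as by auto
  then obtain rk where fin: "finite (Field p)" and p: "p = layered (Field p) rk"
    and card: "\<And>i. i < length as \<Longrightarrow> card {x \<in> Field p. rk x = Suc i} = as ! i"
    using complete_multilevel_rank[OF assms(1)] by metis
  define L where "L i = {x \<in> Field p. rk x = i}" for i
  have LF: "L i \<subseteq> Field p" for i by (auto simp: L_def)
  have inj: "inj_on f (L i)" for i
    using f LF by (auto simp: boolean_embedding_def intro: inj_on_subset)
  have finf: "finite (f x)" if "x \<in> L i" for x i
    using f LF that by (auto simp: boolean_embedding_def)
  have less: "f x \<subset> f y" if "x \<in> L i" "y \<in> L j" "i < j" for x y i j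
  proof -
    have xy: "x \<in> Field p" "y \<in> Field p" "rk x < rk y" using that by (auto simp: L_def)
    then have "(x, y) \<in> p" by (subst p) (auto simp: layered_def)
    then have "f x \<subseteq> f y" using f by (auto simp: boolean_embedding_def)
    moreover have "f x \<noteq> f y" using f xy by (auto simp: boolean_embedding_def inj_on_def)
    ultimately show ?thesis by blast
  qed
  have cardL: "card (f ` L i) = card (L i)" for i using inj by (rule card_image)
  have ne: "L i \<noteq> {}" if "0 < card (L i)" for i using that by auto
  have finU: "finite (\<Union> (f ` L i))" for i
    using finf finite_subset[OF LF fin] by blast
  have finI: "finite (\<Inter> (f ` L i))" if "L i \<noteq> {}" for i using finf that by blast
  have UI: "\<Union> (f ` L i) \<subseteq> \<Inter> (f ` L j)" if "i < j" for i j using less that by blast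
  let ?goal = "\<exists>x\<in>Field p. \<exists>y\<in>Field p. card (f x) + m \<le> card (f y)"
  have conclude: ?goal if "x \<in> L i" "y \<in> L j" "card (f x) + m \<le> card (f y)" for x y i j
    using that LF by blast
  consider "as = [2, 2]" | "as = [1, 3, 1]" | "as = [2, 3, 2]" | "as = [1, 4, 2]" | "as = [1, 4, 4, 1]"
    using as by blast
  then show ?goal
  proof cases
    case 1
    then have c: "card (L 1) = 2" "card (L 2) = 2" using card[of 0] card[of 1] by (auto simp: L_def numeral_2_eq_2)
    obtain x where x: "x \<in> L 1" "card (f x) + 1 \<le> card (\<Union> (f ` L 1))"
      using exists_below_union[OF c(1) inj] finf by blast
    obtain y where y: "y \<in> L 2" "card (\<Inter> (f ` L 2)) + 1 \<le> card (f y)"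
      using exists_above_inter[OF c(2) inj] finf by blast
    have "card (\<Union> (f ` L 1)) \<le> card (\<Inter> (f ` L 2))"
      using UI[of 1 2] finI[of 2] ne[of 2] c by (intro card_mono) auto
    then show ?thesis using x y m 1 by (intro conclude[of x 1 y 2]) auto
  next
    case 2
    then have c: "card (L 1) = 1" "card (L 2) = 3" "card (L 3) = 1"
      using card[of 0] card[of 1] card[of 2] by (auto simp: L_def numeral_2_eq_2 numeral_3_eq_3)
    obtain x y where x: "x \<in> L 1" and y: "y \<in> L 3" using ne[of 1] ne[of 3] c by auto
    have mid: "f x \<subset> Y \<and> Y \<subset> f y" if "Y \<in> f ` L 2" for Y
      using that less[OF x, of _ 2] less[OF _ y, of _ 2] by auto
    have "card (f ` L 2) + 2 \<le> 2 ^ (card (f y) - card (f x))"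
      using mid finf[OF y] ne[of 2] c by (intro card_open_interval_le) auto
    then have "3 \<le> card (f y) - card (f x)" using cardL[of 2] c exponent_ge_3 by simp
    then show ?thesis using x y m 2 by (intro conclude[of x 1 y 3]) auto
  next
    case 3
    then have c: "card (L 1) = 2" "card (L 2) = 3" "card (L 3) = 2"
      using card[of 0] card[of 1] card[of 2] by (auto simp: L_def numeral_2_eq_2 numeral_3_eq_3)
    obtain x where x: "x \<in> L 1" "card (f x) + 1 \<le> card (\<Union> (f ` L 1))"
      using exists_below_union[OF c(1) inj] finf by blast
    obtain y where y: "y \<in> L 3" "card (\<Inter> (f ` L 3)) + 1 \<le> card (f y)"
      using exists_above_inter[OF c(3) inj] finf by blast
    have mid: "\<Union> (f ` L 1) \<subseteq> Y \<and> Y \<subseteq> \<Inter> (f ` L 3)" if Y: "Y \<in> f ` L 2" for Y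
    proof -
      obtain z where z: "z \<in> L 2" "Y = f z" using Y by blast
      have "f u \<subseteq> f z" if "u \<in> L 1" for u using less[OF that z(1)] by auto
      moreover have "f z \<subseteq> f u" if "u \<in> L 3" for u using less[OF z(1) that] by auto
      ultimately show ?thesis using z by blast
    qed
    have "card (f ` L 2) \<le> 2 ^ (card (\<Inter> (f ` L 3)) - card (\<Union> (f ` L 1)))"
      using mid finI[of 3] ne[of 3] c by (intro card_interval_le) auto
    then have "2 \<le> card (\<Inter> (f ` L 3)) - card (\<Union> (f ` L 1))" using cardL[of 2] c exponent_ge_2 by simp
    then show ?thesis using x y m 3 by (intro conclude[of x 1 y 3]) auto
  next
    case 4
    then have c: "card (L 1) = 1" "card (L 2) = 4" "card (L 3) = 2"
      using card[of 0] card[of 1] card[of 2] by (auto simp: L_def numeral_2_eq_2 numeral_3_eq_3)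
    obtain x where x: "x \<in> L 1" using ne[of 1] c by auto
    obtain y where y: "y \<in> L 3" "card (\<Inter> (f ` L 3)) + 1 \<le> card (f y)"
      using exists_above_inter[OF c(3) inj] finf by blast
    have mid: "f x \<subset> Y \<and> Y \<subseteq> \<Inter> (f ` L 3)" if Y: "Y \<in> f ` L 2" for Y
    proof -
      obtain z where z: "z \<in> L 2" "Y = f z" using Y by blast
      have "f z \<subseteq> f u" if "u \<in> L 3" for u using less[OF z(1) that] by auto
      then show ?thesis using z less[OF x z(1)] by auto
    qed
    have "card (f ` L 2) + 1 \<le> 2 ^ (card (\<Inter> (f ` L 3)) - card (f x))"
      using mid finI[of 3] ne[of 3] ne[of 2] c by (intro card_interval_above_le) auto
    then have "3 \<le> card (\<Inter> (f ` L 3)) - card (f x)" using cardL[of 2] c exponent_ge_3 by simp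
    then show ?thesis using x y m 4 by (intro conclude[of x 1 y 3]) auto
  next
    case 5
    then have c: "card (L 1) = 1" "card (L 2) = 4" "card (L 3) = 4" "card (L 4) = 1"
      using card[of 0] card[of 1] card[of 2] card[of 3]
      by (auto simp: L_def numeral_2_eq_2 numeral_3_eq_3 eval_nat_numeral)
    obtain x y where x: "x \<in> L 1" and y: "y \<in> L 4" using ne[of 1] ne[of 4] c by auto
    have lo: "f x \<subset> Y \<and> Y \<subseteq> \<Union> (f ` L 2)" if "Y \<in> f ` L 2" for Y
      using that less[OF x, of _ 2] by fastforce
    have hi: "\<Inter> (f ` L 3) \<subseteq> Y \<and> Y \<subset> f y" if "Y \<in> f ` L 3" for Y
      using that less[OF _ y, of _ 3] by fastforce
    have "card (f ` L 2) + 1 \<le> 2 ^ (card (\<Union> (f ` L 2)) - card (f x))"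
      using lo finU[of 2] ne[of 2] c by (intro card_interval_above_le) auto
    then have 1: "3 \<le> card (\<Union> (f ` L 2)) - card (f x)" using cardL[of 2] c exponent_ge_3 by simp
    have "card (f ` L 3) + 1 \<le> 2 ^ (card (f y) - card (\<Inter> (f ` L 3)))"
      using hi finf[OF y] ne[of 3] c by (intro card_interval_below_le) auto
    then have 2: "3 \<le> card (f y) - card (\<Inter> (f ` L 3))" using cardL[of 3] c exponent_ge_3 by simp
    have "card (\<Union> (f ` L 2)) \<le> card (\<Inter> (f ` L 3))"
      using UI[of 2 3] finI[of 3] ne[of 3] c by (intro card_mono) auto
    then show ?thesis using x y m 5 1 2 by (intro conclude[of x 1 y 4]) auto
  qed
qed

text \<open>
  Everything in \<open>p\<close> is mapped strictly below everything in \<open>q\<close>, which gains the extra \<open>1\<close>. When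
  instead a top and a bottom element are identified, the image of that element links the two
  witnesses and there is no gain.
\<close>

lemma spread_oplus:
  assumes p: "spread_at_least p m" and q: "spread_at_least q n" and disj: "Field p \<inter> Field q = {}"
  shows "spread_at_least (p \<union> q \<union> Field p \<times> Field q) (m + n + 1)"
  unfolding spread_at_least_def
proof (intro allI impI)
  let ?r = "p \<union> q \<union> Field p \<times> Field q"
  fix f assume f: "boolean_embedding ?r f"
  obtain x y where xy: "x \<in> Field p" "y \<in> Field p" "card (f x) + m \<le> card (f y)"
    using p boolean_embedding_mono[OF f, of p] unfolding spread_at_least_def by blast
  obtain u v where uv: "u \<in> Field q" "v \<in> Field q" "card (f u) + n \<le> card (f v)"
    using q boolean_embedding_mono[OF f, of q] unfolding spread_at_least_def by blast
  have yu: "(y, u) \<in> ?r" "y \<noteq> u" using xy uv disj by auto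
  then have "f y \<subset> f u" "finite (f u)" using boolean_embeddingD[OF f] by blast+
  then have "card (f y) < card (f u)" by (simp add: psubset_card_mono)
  moreover have "x \<in> Field ?r" "v \<in> Field ?r" using xy uv by (auto simp: Field_def)
  ultimately show "\<exists>x\<in>Field ?r. \<exists>y\<in>Field ?r. card (f x) + (m + n + 1) \<le> card (f y)"
    using xy uv by (intro bexI[of _ x] bexI[of _ v]) auto
qed

lemma spread_otimes:
  assumes p: "spread_at_least p m" and q: "spread_at_least q n"
    and t: "\<forall>x\<in>Field p. (x, t) \<in> p" "\<forall>y\<in>Field q. (t, y) \<in> q"
  shows "spread_at_least ((p \<union> q)\<^sup>+) (m + n)"
  unfolding spread_at_least_def
proof (intro allI impI)
  let ?r = "(p \<union> q)\<^sup>+"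
  fix f assume f: "boolean_embedding ?r f"
  have sub: "p \<subseteq> ?r" "q \<subseteq> ?r" by auto
  obtain x y where xy: "x \<in> Field p" "y \<in> Field p" "card (f x) + m \<le> card (f y)"
    using p boolean_embedding_mono[OF f sub(1)] by (auto simp: spread_at_least_def)
  obtain u v where uv: "u \<in> Field q" "v \<in> Field q" "card (f u) + n \<le> card (f v)"
    using q boolean_embedding_mono[OF f sub(2)] by (auto simp: spread_at_least_def)
  have "(y, u) \<in> ?r" using t xy uv sub by (meson subset_iff trancl_trans)
  then have "f y \<subseteq> f u" "finite (f u)" using boolean_embeddingD[OF f] by blast+
  then have "card (f y) \<le> card (f u)" by (simp add: card_mono)
  moreover have "x \<in> Field ?r" "v \<in> Field ?r" using xy uv sub mono_Field by (metis subsetD)+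
  ultimately show "\<exists>x\<in>Field ?r. \<exists>y\<in>Field ?r. card (f x) + (m + n) \<le> card (f y)"
    using xy uv by (intro bexI[of _ x] bexI[of _ v]) auto
qed

lemma layered_oplus:
  assumes A: "rk ` A = {1..h}" and B: "rk' ` B = {1..h'}" and disj: "A \<inter> B = {}"
  obtains s where "s ` (A \<union> B) = {1..h + h'}"
    "layered A rk \<union> layered B rk' \<union> A \<times> B = layered (A \<union> B) s"
proof
  let ?s = "\<lambda>x. if x \<in> A then rk x else rk' x + h"
  have sB: "?s x = rk' x + h" if "x \<in> B" for x using that disj by auto
  have "?s ` A = rk ` A" by (intro image_cong) auto
  then have "?s ` (A \<union> B) = {1..h} \<union> ?s ` B" unfolding image_Un A by simp
  also have "?s ` B = (\<lambda>k. k + h) ` {1..h'}"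
    unfolding B[symmetric] image_image using sB by (intro image_cong) auto
  also have "{1..h} \<union> (\<lambda>k. k + h) ` {1..h'} = {1..h + h'}"
  proof -
    have "k \<in> {1..h} \<or> (k - h \<in> {1..h'} \<and> k = (k - h) + h)" if "k \<in> {1..h + h'}" for k
      using that by auto
    then show ?thesis by fastforce
  qed
  finally show "?s ` (A \<union> B) = {1..h + h'}" .
  have rA: "rk x \<le> h" if "x \<in> A" for x using A that by force
  have rB: "1 \<le> rk' x" if "x \<in> B" for x using B that by force
  have "(x, y) \<in> layered A rk \<union> layered B rk' \<union> A \<times> B \<longleftrightarrow> (x, y) \<in> layered (A \<union> B) ?s" for x y
    using disj rA[of x] rA[of y] rB[of x] rB[of y] unfolding layered_def by auto
  then show "layered A rk \<union> layered B rk' \<union> A \<times> B = layered (A \<union> B) ?s"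
    by auto
qed

lemma layered_otimes:
  assumes A: "rk ` A = {1..h}" and B: "rk' ` B = {1..h'}" and t: "A \<inter> B = {t}"
    and top: "\<forall>x\<in>A. (x, t) \<in> layered A rk" and bot: "\<forall>y\<in>B. (t, y) \<in> layered B rk'"
  obtains s where "s ` (A \<union> B) = {1..h + h' - 1}"
    "(layered A rk \<union> layered B rk')\<^sup>+ = layered (A \<union> B) s"
proof
  let ?s = "\<lambda>x. if x \<in> A then rk x else rk' x + h - 1"
  have tA: "t \<in> A" and tB: "t \<in> B" using t by auto
  have topt: "rk x < rk t" if "x \<in> A" "x \<noteq> t" for x using top that by (auto simp: layered_def)
  have bott: "rk' t < rk' y" if "y \<in> B" "y \<noteq> t" for y using bot that by (auto simp: layered_def)
  have rA: "1 \<le> rk x \<and> rk x \<le> h" if "x \<in> A" for x using A that by force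
  have rB: "1 \<le> rk' x \<and> rk' x \<le> h'" if "x \<in> B" for x using B that by force
  have th: "rk t = h"
  proof -
    have "h \<in> rk ` A" using A rA[OF tA] by auto
    then show ?thesis using topt rA[OF tA] by force
  qed
  have t1: "rk' t = 1"
  proof -
    have "1 \<in> rk' ` B" using B rB[OF tB] by auto
    then show ?thesis using bott rB[OF tB] by force
  qed
  have sB: "?s x = rk' x + h - 1" if "x \<in> B" for x
  proof (cases "x \<in> A")
    case True
    then have "x = t" using that t by blast
    then show ?thesis using th t1 tA by simp
  qed simp
  have "?s ` A = rk ` A" by (intro image_cong) auto
  then have "?s ` (A \<union> B) = {1..h} \<union> ?s ` B" unfolding image_Un A by simp
  also have "?s ` B = (\<lambda>k. k + h - 1) ` {1..h'}"
    unfolding B[symmetric] image_image using sB by (intro image_cong) auto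
  also have "{1..h} \<union> (\<lambda>k. k + h - 1) ` {1..h'} = {1..h + h' - 1}"
  proof -
    have "k \<in> {1..h} \<or> (k + 1 - h \<in> {1..h'} \<and> k = (k + 1 - h) + h - 1)" if "k \<in> {1..h + h' - 1}" for k
      using that by auto
    then show ?thesis using rA[OF tA] rB[OF tB] by fastforce
  qed
  finally show "?s ` (A \<union> B) = {1..h + h' - 1}" .
  show "(layered A rk \<union> layered B rk')\<^sup>+ = layered (A \<union> B) ?s" (is "?l = ?r")
  proof
    have "layered A rk \<union> layered B rk' \<subseteq> ?r"
      using sB rB by (fastforce simp: layered_def)
    then have "?l \<subseteq> ?r\<^sup>+" by (meson subsetI trancl_mono)
    then show "?l \<subseteq> ?r" by (simp add: trancl_id[OF trans_layered])
    show "?r \<subseteq> ?l"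
    proof
      fix z assume "z \<in> ?r"
      then obtain x y where z: "z = (x, y)" and xy: "x \<in> A \<union> B" "y \<in> A \<union> B" "x = y \<or> ?s x < ?s y"
        by (auto simp: layered_def)
      consider "x \<in> A" "y \<in> A" | "x \<in> B" "y \<in> B" | "x \<in> A" "y \<in> B" "x \<notin> B" "y \<notin> A"
        | "x \<in> B" "y \<in> A" "x \<notin> A" "y \<notin> B" using xy by blast
      then have "(x, y) \<in> ?l"
      proof cases
        case 1
        then have "(x, y) \<in> layered A rk" using xy by (auto simp: layered_def)
        then show ?thesis by auto
      next
        case 2
        then have "(x, y) \<in> layered B rk'" using xy(3) unfolding sB[OF 2(1)] sB[OF 2(2)]
          by (auto simp: layered_def)
        then show ?thesis by auto
      next
        case 3
        then have "(x, t) \<in> ?l" "(t, y) \<in> ?l" using top bot by auto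
        then show ?thesis by (rule trancl_trans)
      next
        case 4
        have "x \<noteq> t" using 4(3) tA by blast
        then have "1 < rk' x" using bott[OF 4(1)] t1 by simp
        then have "h < ?s x" using 4(3) by simp
        moreover have "?s y \<le> h" using rA[OF 4(2)] 4(2) by simp
        moreover have "x \<noteq> y" using 4 by blast
        ultimately show ?thesis using xy(3) by linarith
      qed
      then show "z \<in> ?l" using z by simp
    qed
  qed
qed

text \<open>
  All members of the class are layered, because both operations preserve that shape. The defining
  feature of the class is that the spread keeps pace with half of \<open>card (Field p) + h - 2\<close>: for \<open>P\<^sub>1 \<oplus> P\<^sub>2\<close> this
  quantity is one plus the sum of the two quantities, and for \<open>P\<^sub>1 \<otimes> P\<^sub>2\<close>, where one element and one
  level are lost, it is their sum.
\<close>

lemma burcsi_nagy_layered: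
  assumes "burcsi_nagy p"
  shows "\<exists>rk h m. finite (Field p) \<and> rk ` Field p = {1..h} \<and> p = layered (Field p) rk \<and>
    card (Field p) + h = 2 * m + 2 \<and> spread_at_least p m"
  using assms
proof induction
  case (single a)
  have "Field {(a, a)} = {a}" by (auto simp: Field_def)
  then show ?case
    by (intro exI[of _ "\<lambda>_. 1"] exI[of _ 1] exI[of _ 0]) (auto simp: layered_def spread_at_least_def)
next
  case (base as p)
  have "0 \<notin> set as" using base by auto
  then obtain rk where rk: "finite (Field p)" "rk ` Field p = {1..length as}" "p = layered (Field p) rk"
      "card (Field p) = sum_list as"
    using complete_multilevel_rank[OF base(1)] by metis
  have "even (sum_list as + length as) \<and> 2 \<le> sum_list as + length as" using base(2) by auto
  then obtain k where "sum_list as + length as = 2 * k" by (metis evenE)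
  then have "sum_list as + length as = 2 * (k - 1) + 2"
    using \<open>even (sum_list as + length as) \<and> 2 \<le> sum_list as + length as\<close> by auto
  then show ?case using rk spread_base[OF base] by metis
next
  case (oplus p q)
  obtain rk h m where P: "finite (Field p)" "rk ` Field p = {1..h}" "p = layered (Field p) rk"
    "card (Field p) + h = 2 * m + 2" "spread_at_least p m" using oplus by blast
  obtain rk' h' m' where Q: "finite (Field q)" "rk' ` Field q = {1..h'}" "q = layered (Field q) rk'"
    "card (Field q) + h' = 2 * m' + 2" "spread_at_least q m'" using oplus by blast
  let ?r = "p \<union> q \<union> Field p \<times> Field q"
  have F: "Field ?r = Field p \<union> Field q" by (auto simp: Field_def)
  obtain s where "s ` (Field p \<union> Field q) = {1..h + h'}" "?r = layered (Field p \<union> Field q) s"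
    using layered_oplus[OF P(2) Q(2) oplus.hyps(3)] P(3) Q(3) by metis
  moreover have "card (Field p \<union> Field q) + (h + h') = 2 * (m + m' + 1) + 2"
    using P(4) Q(4) card_Un_disjoint[OF P(1) Q(1) oplus.hyps(3)] by simp
  ultimately show ?case unfolding F
    using P(1) Q(1) spread_oplus[OF P(5) Q(5) oplus.hyps(3)] by blast
next
  case (otimes p q t)
  obtain rk h m where P: "finite (Field p)" "rk ` Field p = {1..h}" "p = layered (Field p) rk"
    "card (Field p) + h = 2 * m + 2" "spread_at_least p m" using otimes by blast
  obtain rk' h' m' where Q: "finite (Field q)" "rk' ` Field q = {1..h'}" "q = layered (Field q) rk'"
    "card (Field q) + h' = 2 * m' + 2" "spread_at_least q m'" using otimes by blast
  let ?r = "(p \<union> q)\<^sup>+"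
  obtain s where s: "s ` (Field p \<union> Field q) = {1..h + h' - 1}" "?r = layered (Field p \<union> Field q) s"
    using layered_otimes[OF P(2) Q(2) otimes.hyps(3)] otimes.hyps(4,5) P(3) Q(3) by metis
  have F: "Field ?r = Field p \<union> Field q" unfolding s(2) by simp
  have t: "t \<in> Field p" "t \<in> Field q" using otimes.hyps(3) by auto
  then have "1 \<le> h" "1 \<le> h'" using P(2) Q(2) by force+
  moreover have "card (Field p \<union> Field q) + 1 = card (Field p) + card (Field q)"
    using card_Un_Int[OF P(1) Q(1)] otimes.hyps(3) by simp
  ultimately have "card (Field p \<union> Field q) + (h + h' - 1) = 2 * (m + m') + 2"
    using P(4) Q(4) by simp
  then show ?case unfolding F
    using s P(1) Q(1) spread_otimes[OF P(5) Q(5) otimes.hyps(4,5)] by blast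
qed

section \<open>Embedding into a double chain\<close>

text \<open>
  The double chain consists of the sets \<open>A\<^sub>i = {1..i}\<close> and \<open>B\<^sub>i = {1..i-1} \<union> {i+1}\<close>. The number
  \<open>2 * i\<close> stands for \<open>A\<^sub>i\<close> and \<open>2 * i + 1\<close> for \<open>B\<^sub>i\<close>; both have \<open>i\<close> elements. The only
  incomparable pairs of different sizes are \<open>B\<^sub>i\<close> and \<open>B\<^bsub>i+1\<^esub>\<close>.
\<close>

definition dc_less :: "nat \<Rightarrow> nat \<Rightarrow> bool"  (infix "\<lless>" 50) where
  "u \<lless> v \<longleftrightarrow> u div 2 < v div 2 \<and> \<not> (odd u \<and> v = u + 2)"

lemma dc_less_irrefl: "\<not> u \<lless> u"
  by (simp add: dc_less_def)

lemma exists_cut: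
  fixes key :: "'b \<Rightarrow> nat"
  assumes "finite S" "inj_on key S" "k \<le> card S"
  shows "\<exists>c. card {u \<in> S. key u < c} = k"
  using assms(3)
proof (induction k)
  case 0
  show ?case by (intro exI[of _ 0]) simp
next
  case (Suc k)
  then obtain c where c: "card {u \<in> S. key u < c} = k" by auto
  define R where "R = {u \<in> S. c \<le> key u}"
  have "S = {u \<in> S. key u < c} \<union> R" by (auto simp: R_def)
  then have "R \<noteq> {}" using c Suc.prems by force
  then obtain w where w: "w \<in> R" "\<And>v. v \<in> R \<Longrightarrow> key w \<le> key v"
    using ex_has_least_nat[of "\<lambda>u. u \<in> R" _ key] by blast
  have "{u \<in> S. key u < Suc (key w)} = insert w {u \<in> S. key u < c}" (is "?l = ?r")
  proof
    show "?r \<subseteq> ?l" using w by (auto simp: R_def)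
    show "?l \<subseteq> ?r"
    proof
      fix u assume u: "u \<in> ?l"
      show "u \<in> ?r"
      proof (cases "key u < c")
        case False
        then have "key w \<le> key u" using u w(2) by (auto simp: R_def)
        then have "key u = key w" using u by auto
        then have "u = w" using assms(2) u w(1) by (auto simp: R_def inj_on_def)
        then show ?thesis by simp
      qed (use u in auto)
    qed
  qed
  moreover have "w \<notin> {u \<in> S. key u < c}" using w by (auto simp: R_def)
  ultimately have "card {u \<in> S. key u < Suc (key w)} = Suc k" using c assms(1) by simp
  then show ?case by blast
qed

text \<open>
  A cut of the double chain separates comparable sets, up to one set right above it. If \<open>A\<^sub>i\<close> is the last
  set below the cut, then only \<open>B\<^sub>i\<close> causes trouble; if \<open>B\<^sub>i\<close> is the last, only \<open>B\<^bsub>i+1\<^esub>\<close> does.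
\<close>

lemma skip_one:
  shows "\<exists>d. \<forall>u v. u < c \<longrightarrow> c \<le> v \<longrightarrow> v \<noteq> d \<longrightarrow> u \<lless> v"
proof (intro exI allI impI)
  fix u v :: nat
  assume "u < c" "c \<le> v" "v \<noteq> (if odd c then c else c + 1)"
  then show "u \<lless> v" unfolding dc_less_def by presburger
qed

text \<open>
  Instead of being thrown away, the exceptional set \<open>d\<close> above a cut can serve as the new element of a
  \<open>\<Lambda>\<close>-extension: being some \<open>B\<^sub>i\<close>, it is incomparable below the cut to \<open>A\<^sub>i\<close> and \<open>B\<^bsub>i-1\<^esub>\<close>
  only. If no set of \<open>S\<close> is exceptional, any one above the cut will do.
\<close>

lemma lower_split:
  assumes S: "finite S" "card S = p + q + 1"
  shows "\<exists>G d. G \<subseteq> S \<and> card G = p \<and> d \<in> S - G \<and> (\<forall>u\<in>G. \<forall>v\<in>S - G - {d}. u \<lless> v) \<and>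
    card {u \<in> G. \<not> u \<lless> d} \<le> 2"
proof -
  obtain c where c: "card {u \<in> S. u < c} = p"
    using exists_cut[of S "\<lambda>u. u" p] S by auto
  define G where "G = {u \<in> S. u < c}"
  have GS: "G \<subseteq> S" by (auto simp: G_def)
  obtain e where e: "\<And>u v. u < c \<Longrightarrow> c \<le> v \<Longrightarrow> v \<noteq> e \<Longrightarrow> u \<lless> v"
    using skip_one[of c] by blast
  have "card (S - G) = q + 1" using S c GS by (simp add: card_Diff_subset finite_subset G_def)
  then have "S - G \<noteq> {}" by force
  then obtain d where d: "d \<in> S - G" "e \<in> S - G \<Longrightarrow> d = e" by blast
  have "{u \<in> G. \<not> u \<lless> d} \<subseteq> {d - 1, d - 2}"
  proof
    fix u assume "u \<in> {u \<in> G. \<not> u \<lless> d}"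
    moreover have "c \<le> d" using d by (auto simp: G_def)
    ultimately have "u < d" "\<not> u \<lless> d" by (auto simp: G_def)
    then have "u = d - 1 \<or> u = d - 2" unfolding dc_less_def by presburger
    then show "u \<in> {d - 1, d - 2}" by auto
  qed
  then have "card {u \<in> G. \<not> u \<lless> d} \<le> card {d - 1, d - 2}" by (intro card_mono) auto
  also have "\<dots> \<le> 2" by (simp add: card_insert_if)
  finally have "card {u \<in> G. \<not> u \<lless> d} \<le> 2" .
  moreover have "\<forall>u\<in>G. \<forall>v\<in>S - G - {d}. u \<lless> v"
  proof (intro ballI)
    fix u v assume "u \<in> G" "v \<in> S - G - {d}"
    then show "u \<lless> v" using d by (intro e) (auto simp: G_def)
  qed
  ultimately show ?thesis using GS c d by (intro exI[of _ G] exI[of _ d]) (auto simp: G_def)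
qed

text \<open>
  The dual statement for \<open>V\<close>-extensions needs an exceptional set \<open>d\<close> below the cut. It exists if each
  \<open>B\<^sub>i\<close> is listed before \<open>A\<^sub>i\<close>, since the passage to complements, which reverses the double chain, exchanges the
  two orders within a level. The function \<open>key\<close> is the position in this second list.
\<close>

lemma upper_split:
  assumes S: "finite S" "card S = p + q + 1"
  shows "\<exists>H d. H \<subseteq> S \<and> card H = p \<and> d \<in> S - H \<and> (\<forall>u\<in>S - H - {d}. \<forall>v\<in>H. u \<lless> v) \<and>
    card {v \<in> H. \<not> d \<lless> v} \<le> 2"
proof -
  define key :: "nat \<Rightarrow> nat" where "key u = (if even u then u + 1 else u - 1)" for u
  have "u = v" if "key u = key v" for u v
    using that unfolding key_def by (cases "even u"; cases "even v"; simp; presburger)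
  then have "inj_on key S" by (simp add: inj_on_def)
  then obtain c where c: "card {u \<in> S. key u < c} = q + 1"
    using exists_cut[of S key "q + 1"] S by auto
  define G where "G = {u \<in> S. key u < c}"
  have GS: "G \<subseteq> S" by (auto simp: G_def)
  have cH: "card (S - G) = p" using S c GS by (simp add: card_Diff_subset finite_subset G_def)
  have halves: "\<exists>i. u = 2 * i \<or> u = 2 * i + 1" for u :: nat by presburger
  obtain k where k: "c - 1 = 2 * k \<or> c - 1 = 2 * k + 1" using halves by blast
  \<comment> \<open>If the cut is inside or at the end of level \<open>k\<close>, the exception is \<open>B\<^sub>k\<close>.\<close>
  define e where "e = 2 * k + 1"
  have e: "u \<lless> v" if "key u < c" "c \<le> key v" "u \<noteq> e" for u v
  proof -
    obtain i j where "u = 2 * i \<or> u = 2 * i + 1" "v = 2 * j \<or> v = 2 * j + 1"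
      using halves by blast
    then show ?thesis using that k unfolding dc_less_def key_def e_def by auto
  qed
  have "G \<noteq> {}" using c G_def by force
  then obtain d where d: "d \<in> G" "e \<in> G \<Longrightarrow> d = e" by blast
  have "{v \<in> S - G. \<not> d \<lless> v} \<subseteq> {d - 1, d + 2}"
  proof
    fix v assume "v \<in> {v \<in> S - G. \<not> d \<lless> v}"
    then have "key d < c" "c \<le> key v" "\<not> d \<lless> v" using d by (auto simp: G_def)
    then have "key d < key v" "\<not> d \<lless> v" by auto
    moreover obtain i j where "d = 2 * i \<or> d = 2 * i + 1" "v = 2 * j \<or> v = 2 * j + 1"
      using halves by blast
    ultimately have "v = d - 1 \<or> v = d + 2" unfolding dc_less_def key_def by auto
    then show "v \<in> {d - 1, d + 2}" by auto
  qed
  then have "card {v \<in> S - G. \<not> d \<lless> v} \<le> card {d - 1, d + 2}" by (intro card_mono) auto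
  also have "\<dots> \<le> 2" by (simp add: card_insert_if)
  finally have "card {v \<in> S - G. \<not> d \<lless> v} \<le> 2" .
  moreover have "S - (S - G) = G" using GS by auto
  moreover have "\<forall>u\<in>G - {d}. \<forall>v\<in>S - G. u \<lless> v"
  proof (intro ballI)
    fix u v assume "u \<in> G - {d}" "v \<in> S - G"
    then show "u \<lless> v" using d by (intro e) (auto simp: G_def)
  qed
  ultimately show ?thesis using d cH by (intro exI[of _ "S - G"] exI[of _ d]) auto
qed

lemma bij_betw_onto_subset:
  assumes "finite X" "finite Y" "card X = card Y" "X0 \<subseteq> X" "Y0 \<subseteq> Y" "card X0 = card Y0"
  shows "\<exists>f. bij_betw f X Y \<and> f ` X0 = Y0"
proof -
  have fin: "finite X0" "finite Y0" using assms by (auto intro: finite_subset)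
  obtain f where f: "bij_betw f X0 Y0"
    using fin assms(6) by (metis finite_same_card_bij)
  have "card (X - X0) = card (Y - Y0)" using assms fin by (simp add: card_Diff_subset)
  then obtain g where g: "bij_betw g (X - X0) (Y - Y0)"
    using assms(1,2) by (metis finite_Diff finite_same_card_bij)
  let ?h = "\<lambda>x. if x \<in> X0 then f x else g x"
  have "bij_betw ?h (X0 \<union> (X - X0)) (Y0 \<union> (Y - Y0))"
    by (rule bij_betw_disjoint_Un[OF f g]) auto
  moreover have "X0 \<union> (X - X0) = X" "Y0 \<union> (Y - Y0) = Y" using assms by auto
  moreover have "?h ` X0 = Y0" using f by (simp add: bij_betw_def)
  ultimately show ?thesis by auto
qed

text \<open>
  Only the number of bad elements of \<open>G\<close> is known, so the bijection has to send the two elements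
  \<open>a, b\<close> that are unrelated to \<open>x\<close> onto a pair containing them. The relation is arbitrary in order that
  the lemma applies to the double chain in both directions.
\<close>

lemma merged_block_embedding:
  fixes R :: "'b \<Rightarrow> 'b \<Rightarrow> bool"
  assumes fin: "finite G0" "finite H0" "finite S" and disj: "G0 \<inter> H0 = {}" and x: "x \<in> H0"
    and ab: "a \<in> G0" "b \<in> G0" "a \<noteq> b"
    and G: "G \<subseteq> S" "card G = card G0" and card: "card S = card G0 + card H0" and d: "d \<in> S - G"
    and R: "\<forall>u\<in>G. \<forall>v\<in>S - G - {d}. R u v" and bad: "card {u \<in> G. \<not> R u d} \<le> 2"
  shows "\<exists>g. bij_betw g (G0 \<union> H0) S \<and>
    (\<forall>u\<in>G0. \<forall>v\<in>H0. \<not> (v = x \<and> u \<in> {a, b}) \<longrightarrow> R (g u) (g v))"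
proof -
  have finG: "finite G" using G fin by (auto intro: finite_subset)
  have "card {a, b} \<le> card G0" using ab fin by (intro card_mono) auto
  then have "2 \<le> card G" using ab G by simp
  then obtain B where B: "{u \<in> G. \<not> R u d} \<subseteq> B" "B \<subseteq> G" "card B = 2"
    using exists_subset_between[of "{u \<in> G. \<not> R u d}" 2 G] bad finG by auto
  obtain f where f: "bij_betw f G0 G" "f ` {a, b} = B"
    using bij_betw_onto_subset[of G0 G "{a, b}" B] fin finG G ab B by auto
  have cH: "card (S - G) = card H0" using card G finG by (simp add: card_Diff_subset)
  obtain f' where f': "bij_betw f' H0 (S - G)" "f' ` {x} = {d}"
    using bij_betw_onto_subset[of H0 "S - G" "{x}" "{d}"] fin cH x d by auto
  let ?g = "\<lambda>u. if u \<in> G0 then f u else f' u"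
  have "bij_betw ?g (G0 \<union> H0) (G \<union> (S - G))"
    by (rule bij_betw_disjoint_Un[OF f(1) f'(1) disj]) auto
  then have "bij_betw ?g (G0 \<union> H0) S" using G by (simp add: Un_absorb1)
  moreover have "R (?g u) (?g v)" if u: "u \<in> G0" and v: "v \<in> H0" and ne: "\<not> (v = x \<and> u \<in> {a, b})" for u v
  proof -
    have v': "v \<notin> G0" using v disj by auto
    have fu: "f u \<in> G" using f u by (auto simp: bij_betw_def)
    have fv: "f' v \<in> S - G" using f' v by (auto simp: bij_betw_def)
    have "R (f u) (f' v)"
    proof (cases "v = x")
      case False
      then have "f' v \<noteq> d" using f' v x by (auto simp: bij_betw_def inj_on_def)
      then show ?thesis using R fu fv by auto
    next
      case True
      then have "u \<notin> {a, b}" using ne by auto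
      then have "f u \<notin> B" using f u ab by (auto simp: bij_betw_def inj_on_def)
      then show ?thesis using B fu True f'(2) by auto
    qed
    then show ?thesis using u v' by simp
  qed
  ultimately show ?thesis by blast
qed

text \<open>
  The blocks of \<open>A\<close> are placed one after the other at the bottom of what remains of \<open>S\<close>, and by
  \<open>skip_one\<close> a single set is sacrificed between consecutive blocks: \<open>k\<close> blocks cost \<open>k - 1\<close> sets.
\<close>

lemma greedy_embedding:
  fixes b :: "'a \<Rightarrow> nat"
  assumes finA: "finite A" and bA: "b ` A \<subseteq> {1..k}" and r: "r \<subseteq> A \<times> A"
    and mono: "\<And>u v. (u, v) \<in> r \<Longrightarrow> b u \<le> b v"
    and blocks: "\<And>j T. j \<in> {1..k} \<Longrightarrow> finite T \<Longrightarrow> card T = card {x \<in> A. b x = j} \<Longrightarrow>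
      \<exists>g. bij_betw g {x \<in> A. b x = j} T \<and>
        (\<forall>(u, v)\<in>r. u \<noteq> v \<longrightarrow> b u = j \<longrightarrow> b v = j \<longrightarrow> g u \<lless> g v)"
    and S: "finite S" "card A + k \<le> card S + 1"
  shows "\<exists>g. inj_on g A \<and> g ` A \<subseteq> S \<and> (\<forall>(u, v)\<in>r. u \<noteq> v \<longrightarrow> g u \<lless> g v)"
proof -
  define L where "L j = {x \<in> A. b x \<le> j}" for j
  have "\<exists>g R. R \<subseteq> S \<and> g ` L j \<subseteq> S \<and> inj_on g (L j) \<and> (\<forall>u\<in>L j. \<forall>v\<in>R. g u \<lless> v) \<and>
      (\<forall>(u, v)\<in>r. u \<noteq> v \<longrightarrow> u \<in> L j \<longrightarrow> v \<in> L j \<longrightarrow> g u \<lless> g v) \<and> card S \<le> card R + card (L j) + j"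
    if "j \<le> k" for j
    using that
  proof (induction j)
    case 0
    have "b x \<noteq> 0" if "x \<in> A" for x using bA that by force
    then have "L 0 = {}" by (auto simp: L_def)
    then show ?case by (intro exI[of _ "\<lambda>_. 0"] exI[of _ S]) auto
  next
    case (Suc j)
    then have "j \<le> k" by simp
    obtain g R where R: "R \<subseteq> S" and gS: "g ` L j \<subseteq> S" and inj: "inj_on g (L j)"
      and gR': "\<forall>u\<in>L j. \<forall>v\<in>R. g u \<lless> v"
      and gr': "\<forall>(u, v)\<in>r. u \<noteq> v \<longrightarrow> u \<in> L j \<longrightarrow> v \<in> L j \<longrightarrow> g u \<lless> g v"
      and cS: "card S \<le> card R + card (L j) + j"
      using Suc.IH[OF \<open>j \<le> k\<close>] by (elim exE conjE) (rule that)
    have gR: "g u \<lless> v" if "u \<in> L j" "v \<in> R" for u v using gR' that by blast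
    have gr: "g u \<lless> g v" if "(u, v) \<in> r" "u \<noteq> v" "u \<in> L j" "v \<in> L j" for u v
      using bspec[OF gr' that(1)] that by simp
    define N where "N = {x \<in> A. b x = Suc j}"
    have LN: "L (Suc j) = L j \<union> N" "L j \<inter> N = {}" by (auto simp: L_def N_def)
    have finL: "finite (L i)" for i using finA by (auto simp: L_def)
    have finN: "finite N" using finA by (auto simp: N_def)
    have cL: "card (L (Suc j)) = card (L j) + card N"
      using LN finL finN by (simp add: card_Un_disjoint)
    have "card (L (Suc j)) \<le> card A" using finA by (intro card_mono) (auto simp: L_def)
    then have cN: "card N \<le> card R" using cL cS S(2) Suc.prems by linarith
    have finR: "finite R" using R S by (auto intro: finite_subset)
    obtain c where c: "card {u \<in> R. u < c} = card N"
      using exists_cut[of R "\<lambda>u. u" "card N"] finR cN by auto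
    define T where "T = {u \<in> R. u < c}"
    have TR: "T \<subseteq> R" by (auto simp: T_def)
    have "finite T" using finR TR by (auto intro: finite_subset)
    then have "\<exists>g. bij_betw g N T \<and> (\<forall>(u, v)\<in>r. u \<noteq> v \<longrightarrow> b u = Suc j \<longrightarrow> b v = Suc j \<longrightarrow> g u \<lless> g v)"
      unfolding N_def using c Suc.prems by (intro blocks) (simp_all add: T_def N_def)
    then obtain g' where g': "bij_betw g' N T"
      and g'r': "\<forall>(u, v)\<in>r. u \<noteq> v \<longrightarrow> b u = Suc j \<longrightarrow> b v = Suc j \<longrightarrow> g' u \<lless> g' v"
      by (elim exE conjE) (rule that)
    have g'r: "g' u \<lless> g' v" if "(u, v) \<in> r" "u \<noteq> v" "b u = Suc j" "b v = Suc j" for u v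
      using bspec[OF g'r' that(1)] that by simp
    obtain d where d: "\<And>u v. u < c \<Longrightarrow> c \<le> v \<Longrightarrow> v \<noteq> d \<Longrightarrow> u \<lless> v"
      using skip_one[of c] by blast
    define R' where "R' = R - T - {d}"
    define g'' where "g'' x = (if x \<in> L j then g x else g' x)" for x
    have g''N: "g'' x = g' x \<and> g' x \<in> T" if "x \<in> N" for x
      using that LN g' by (auto simp: g''_def bij_betw_def)
    have g''L: "g'' x = g x" if "x \<in> L j" for x using that by (simp add: g''_def)
    have split: "x \<in> L j \<or> x \<in> N" if "x \<in> L (Suc j)" for x using that LN by auto
    have "R' \<subseteq> S" using R by (auto simp: R'_def)
    moreover have "g'' ` L (Suc j) \<subseteq> S"
    proof (rule image_subsetI)
      fix x assume "x \<in> L (Suc j)"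
      then show "g'' x \<in> S"
        using split[of x] g''L[of x] g''N[of x] gS R TR by (metis image_subset_iff subsetD)
    qed
    moreover have "inj_on g'' (L (Suc j))"
    proof (rule inj_onI)
      have new: "g x \<noteq> g' y" if "x \<in> L j" "y \<in> N" for x y
        using gR[OF that(1)] g''N[OF that(2)] TR dc_less_irrefl by (metis subsetD)
      fix x y assume xy: "x \<in> L (Suc j)" "y \<in> L (Suc j)" "g'' x = g'' y"
      then consider "x \<in> L j" "y \<in> L j" | "x \<in> N" "y \<in> N" | "x \<in> L j" "y \<in> N" | "x \<in> N" "y \<in> L j"
        using split by blast
      then show "x = y"
      proof cases
        case 1
        then show ?thesis using inj xy(3) g''L by (simp add: inj_on_def)
      next
        case 2
        then show ?thesis using g' xy(3) g''N by (simp add: bij_betw_def inj_on_def)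
      next
        case 3
        then show ?thesis using new xy(3) g''L g''N by metis
      next
        case 4
        then show ?thesis using new xy(3) g''L g''N by metis
      qed
    qed
    moreover have "g'' u \<lless> v" if u: "u \<in> L (Suc j)" and v: "v \<in> R'" for u v
      using split[OF u]
    proof
      assume "u \<in> L j"
      then show ?thesis using gR g''L v by (auto simp: R'_def)
    next
      assume "u \<in> N"
      then have "g'' u < c" using g''N by (auto simp: T_def)
      moreover have "c \<le> v" "v \<noteq> d" using v by (auto simp: R'_def T_def)
      ultimately show ?thesis by (rule d)
    qed
    moreover have "g'' u \<lless> g'' v" if uv: "(u, v) \<in> r" "u \<noteq> v" "u \<in> L (Suc j)" "v \<in> L (Suc j)" for u v
    proof -
      consider "u \<in> L j" "v \<in> L j" | "u \<in> N" "v \<in> N" | "u \<in> L j" "v \<in> N" | "u \<in> N" "v \<in> L j"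
        using split uv by blast
      then show ?thesis
      proof cases
        case 1
        then show ?thesis using gr uv g''L by simp
      next
        case 2
        then show ?thesis using g'r uv g''N by (auto simp: N_def)
      next
        case 3
        then show ?thesis using gR g''L g''N TR by (metis subsetD)
      next
        case 4
        then show ?thesis using mono[OF uv(1)] by (auto simp: N_def L_def)
      qed
    qed
    moreover have "card S \<le> card R' + card (L (Suc j)) + Suc j"
    proof -
      have "card R = card T + card (R - T)"
        using TR finR by (simp add: card_Diff_subset card_mono finite_subset)
      moreover have "card (R - T) \<le> card R' + 1"
        unfolding R'_def using diff_card_le_card_Diff[of "{d}" "R - T"] by simp
      ultimately show ?thesis using cS cL c by (simp add: T_def)
    qed
    ultimately show ?case by (intro exI[of _ g''] exI[of _ R'] conjI ballI) (assumption | auto)+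
  qed
  from this[OF order_refl] obtain g where g: "g ` L k \<subseteq> S" "inj_on g (L k)"
    and gr: "\<forall>(u, v)\<in>r. u \<noteq> v \<longrightarrow> u \<in> L k \<longrightarrow> v \<in> L k \<longrightarrow> g u \<lless> g v"
    by (elim exE conjE) (rule that)
  have Lk: "L k = A" using bA by (auto simp: L_def)
  have "g u \<lless> g v" if "(u, v) \<in> r" "u \<noteq> v" for u v
    using bspec[OF gr that(1)] that r unfolding Lk by auto
  then have "\<forall>(u, v)\<in>r. u \<noteq> v \<longrightarrow> g u \<lless> g v" by auto
  then show ?thesis using g unfolding Lk by (intro exI[of _ g] conjI)
qed

section \<open>Extensions: auxiliary graph and embedding into the double chain\<close>

text \<open>
  A layered poset lacking the relations between \<open>x\<close> and two elements \<open>a, b\<close> of the level right below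
  (the result of a \<open>\<Lambda>\<close>-extension) or right above (a \<open>V\<close>-extension). The assumption \<open>below\<close> keeps the
  ranks equal to the levels.
\<close>

locale extension =
  fixes A :: "'a set" and s :: "'a \<Rightarrow> nat" and h :: nat and x a b :: 'a and Q :: "'a rel"
  assumes finA: "finite A" and sA: "s ` A = {1..h}"
    and x: "x \<in> A" and ab: "a \<in> A" "b \<in> A" "a \<noteq> b"
    and shape: "Q = {a, b} \<times> {x} \<and> s a = s b \<and> s x = Suc (s a) \<or>
      Q = {x} \<times> {a, b} \<and> s a = s b \<and> s a = Suc (s x)"
    and below: "\<And>u. u \<in> A \<Longrightarrow> 1 < s u \<Longrightarrow> \<exists>v\<in>A. Suc (s v) = s u \<and> (v, u) \<notin> Q"
begin

abbreviation E where "E \<equiv> layered A s - Q"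

lemma Q_rank: "(u, v) \<in> Q \<Longrightarrow> s v = Suc (s u)"
  using shape by auto

lemma Field_E [simp]: "Field E = A"
  using Q_rank by (rule Field_layered_minus)

sublocale ranked_poset E s h
  using finA sA Q_rank below by (rule ranked_layered_minus)

lemma incomparable_E:
  assumes "incomparable E u v" "u \<in> A" "v \<in> A" "s v = Suc (s u)"
  shows "(u, v) \<in> Q"
  using assms by (auto simp: incomparable_def layered_def)

text \<open>
  Incomparable elements of consecutive levels form a pair in \<open>Q\<close>. A triple of either type contains two such
  pairs, which are therefore all of \<open>Q\<close>.
\<close>

lemma aux_vertices_E: "aux_vertices E = {{a, b, x}}"
proof
  show "aux_vertices E \<subseteq> {{a, b, x}}"
  proof
    fix v assume "v \<in> aux_vertices E"
    then consider "V_type E v" | "Lambda_type E v" by (auto simp: aux_vertices_def)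
    then show "v \<in> {{a, b, x}}"
    proof cases
      case 1
      then obtain u y z i where v: "v = {u, y, z}"
        and inc: "incomparable E u y" "incomparable E u z" "incomparable E y z"
        and lev: "u \<in> level E i" "y \<in> level E (i + 1)" "z \<in> level E (i + 1)"
        unfolding V_type_def by blast
      have "(u, y) \<in> Q" "(u, z) \<in> Q"
        using inc lev incomparable_E by (auto simp: level_eq)
      moreover have "y \<noteq> z" using inc(3) refl[of y] lev by (auto simp: incomparable_def level_eq)
      ultimately show ?thesis using shape v by auto
    next
      case 2
      then obtain y z u i where v: "v = {y, z, u}"
        and inc: "incomparable E y z" "incomparable E y u" "incomparable E z u"
        and lev: "y \<in> level E i" "z \<in> level E i" "u \<in> level E (i + 1)"
        unfolding Lambda_type_def by blast
      have "(y, u) \<in> Q" "(z, u) \<in> Q"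
        using inc lev incomparable_E by (auto simp: level_eq)
      moreover have "y \<noteq> z" using inc(1) refl[of y] lev by (auto simp: incomparable_def level_eq)
      ultimately show ?thesis using shape v by auto
    qed
  qed
  have inc: "incomparable E u v" if "(u, v) \<in> Q \<or> u \<noteq> v \<and> s u = s v" for u v
    using that Q_rank[of u v] by (auto simp: incomparable_def layered_def)
  have inc': "incomparable E u v" if "(v, u) \<in> Q" for u v
    using inc[of v u] that by (auto simp: incomparable_def)
  have lev: "u \<in> level E (s u)" if "u \<in> A" for u using that by (simp add: level_eq)
  have "V_type E {a, b, x} \<or> Lambda_type E {a, b, x}"
    using shape
  proof
    assume *: "Q = {a, b} \<times> {x} \<and> s a = s b \<and> s x = Suc (s a)"
    then have "incomparable E a b" "incomparable E a x" "incomparable E b x"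
      using ab inc[of a b] inc[of a x] inc[of b x] by blast+
    moreover have "b \<in> level E (s a)" "x \<in> level E (s a + 1)"
      using * lev[OF ab(2)] lev[OF x] by simp_all
    ultimately have "Lambda_type E {a, b, x}"
      unfolding Lambda_type_def using lev[OF ab(1)] by blast
    then show ?thesis ..
  next
    assume *: "Q = {x} \<times> {a, b} \<and> s a = s b \<and> s a = Suc (s x)"
    then have "incomparable E a b" "incomparable E x a" "incomparable E x b"
      using ab inc[of a b] inc[of x a] inc[of x b] by blast+
    moreover have "s a = s x + 1" "s b = s x + 1" using * by simp_all
    then have "a \<in> level E (s x + 1)" "b \<in> level E (s x + 1)"
      using lev[OF ab(1)] lev[OF ab(2)] by metis+
    moreover have "{a, b, x} = {x, a, b}" by auto
    ultimately have "V_type E {a, b, x}"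
      unfolding V_type_def using lev[OF x] by blast
    then show ?thesis ..
  qed
  then show "{{a, b, x}} \<subseteq> aux_vertices E" by (simp add: aux_vertices_def)
qed

lemma aux_alpha_E: "aux_alpha E = 1"
proof -
  have "{card I |I. I \<subseteq> aux_vertices E \<and> (\<forall>v\<in>I. \<forall>w\<in>I. \<not> aux_adj E v w)} = {0, 1}" (is "?l = _")
  proof
    show "?l \<subseteq> {0, 1}" by (auto simp: aux_vertices_E subset_singleton_iff)
    have "0 \<in> ?l" by (intro CollectI exI[of _ "{}"]) auto
    moreover have "1 \<in> ?l"
      by (intro CollectI exI[of _ "{{a, b, x}}"]) (auto simp: aux_vertices_E aux_adj_def)
    ultimately show "{0, 1} \<subseteq> ?l" by auto
  qed
  then show ?thesis by (simp add: aux_alpha_def)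
qed

lemma merged_levels_embedding:
  fixes T :: "nat set"
  assumes T: "finite T" "card T = card {u \<in> A. s u \<in> {c, Suc c}}"
    and c: "c = min (s x) (s a)"
  shows "\<exists>g. bij_betw g {u \<in> A. s u \<in> {c, Suc c}} T \<and>
    (\<forall>(u, v)\<in>E. u \<noteq> v \<longrightarrow> s u \<in> {c, Suc c} \<longrightarrow> s v \<in> {c, Suc c} \<longrightarrow> g u \<lless> g v)"
proof -
  define G0 H0 where "G0 = {u \<in> A. s u = c}" and "H0 = {u \<in> A. s u = Suc c}"
  have block: "{u \<in> A. s u \<in> {c, Suc c}} = G0 \<union> H0" and disj: "G0 \<inter> H0 = {}"
    by (auto simp: G0_def H0_def)
  have fin: "finite G0" "finite H0" using finA by (auto simp: G0_def H0_def)
  have cT: "card T = card G0 + card H0"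
    using T block disj fin by (simp add: card_Un_disjoint)
  have pairs: "u \<in> G0 \<and> v \<in> H0 \<and> (u, v) \<notin> Q"
    if "(u, v) \<in> E" "u \<noteq> v" "s u \<in> {c, Suc c}" "s v \<in> {c, Suc c}" for u v
    using that by (auto simp: layered_def G0_def H0_def)
  from shape show ?thesis
  proof
    assume *: "Q = {a, b} \<times> {x} \<and> s a = s b \<and> s x = Suc (s a)"
    have mem: "a \<in> G0" "b \<in> G0" "x \<in> H0" using * ab x c by (auto simp: G0_def H0_def)
    have pos: "1 \<le> card G0" "1 \<le> card H0" using mem fin by (auto simp: Suc_le_eq card_gt_0_iff)
    then have split: "card T = card G0 + (card H0 - 1) + 1" using cT by simp
    obtain G d where G: "G \<subseteq> T" "card G = card G0" and d: "d \<in> T - G"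
        "\<forall>u\<in>G. \<forall>v\<in>T - G - {d}. u \<lless> v" "card {u \<in> G. \<not> u \<lless> d} \<le> 2"
      using lower_split[OF T(1) split] by (elim exE conjE) (rule that)
    obtain g where g: "bij_betw g (G0 \<union> H0) T"
        "\<forall>u\<in>G0. \<forall>v\<in>H0. \<not> (v = x \<and> u \<in> {a, b}) \<longrightarrow> g u \<lless> g v"
      using merged_block_embedding[OF fin T(1) disj mem(3,1,2) ab(3) G cT d] by (elim exE conjE) (rule that)
    have "g u \<lless> g v" if "(u, v) \<in> E" "u \<noteq> v" "s u \<in> {c, Suc c}" "s v \<in> {c, Suc c}" for u v
      using pairs[OF that] g(2) * by auto
    then show ?thesis using g(1) unfolding block by (intro exI[of _ g]) auto
  next
    assume *: "Q = {x} \<times> {a, b} \<and> s a = s b \<and> s a = Suc (s x)"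
    have mem: "a \<in> H0" "b \<in> H0" "x \<in> G0" using * ab x c by (auto simp: G0_def H0_def)
    have pos: "1 \<le> card G0" "1 \<le> card H0" using mem fin by (auto simp: Suc_le_eq card_gt_0_iff)
    then have split: "card T = card H0 + (card G0 - 1) + 1" using cT by simp
    obtain H d where H: "H \<subseteq> T" "card H = card H0" and d: "d \<in> T - H"
        "\<forall>u\<in>T - H - {d}. \<forall>v\<in>H. u \<lless> v" "card {v \<in> H. \<not> d \<lless> v} \<le> 2"
      using upper_split[OF T(1) split] by (elim exE conjE) (rule that)
    have disj': "H0 \<inter> G0 = {}" and cT': "card T = card H0 + card G0" using disj cT by auto
    obtain g where g: "bij_betw g (H0 \<union> G0) T"
        "\<forall>u\<in>H0. \<forall>v\<in>G0. \<not> (v = x \<and> u \<in> {a, b}) \<longrightarrow> g v \<lless> g u"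
      using merged_block_embedding[OF fin(2,1) T(1) disj' mem(3,1,2) ab(3) H cT' d(1), of "\<lambda>u v. v \<lless> u"] d(2,3)
      by blast
    have "g u \<lless> g v" if "(u, v) \<in> E" "u \<noteq> v" "s u \<in> {c, Suc c}" "s v \<in> {c, Suc c}" for u v
      using pairs[OF that] g(2) * by auto
    then show ?thesis using g(1) unfolding block by (intro exI[of _ g]) (auto simp: Un_commute)
  qed
qed

text \<open>
  The heart of the upper bound. The two levels containing \<open>x\<close> and \<open>a, b\<close> are placed as one block, within
  which no set of the double chain is sacrificed. Hence one set is saved, exactly enough to accommodate the
  additional element \<open>x\<close>.
\<close>

lemma extension_embedding:
  fixes S :: "nat set"
  assumes S: "finite S" "card A + h \<le> card S + 2"
  shows "\<exists>g. inj_on g A \<and> g ` A \<subseteq> S \<and> (\<forall>(u, v)\<in>E. u \<noteq> v \<longrightarrow> g u \<lless> g v)"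
proof -
  define c where "c = min (s x) (s a)"
  have rng: "1 \<le> s u \<and> s u \<le> h" if "u \<in> A" for u using sA that by force
  have c: "1 \<le> c" "Suc c \<le> h"
    using rng[OF x] rng[OF ab(1)] shape by (auto simp: c_def)
  \<comment> \<open>Merge the levels \<open>c\<close> and \<open>c + 1\<close> and renumber the levels above.\<close>
  define bl where "bl u = (if s u \<le> c then s u else s u - 1)" for u
  have blc: "bl u = c \<longleftrightarrow> s u \<in> {c, Suc c}" if "u \<in> A" for u
    using rng[OF that] c by (auto simp: bl_def)
  have blj: "bl u = bl v \<longrightarrow> bl u \<noteq> c \<longrightarrow> s u = s v" for u v
    by (auto simp: bl_def split: if_splits)
  show ?thesis
  proof (rule greedy_embedding[OF finA])
    show "bl ` A \<subseteq> {1..h - 1}"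
    proof (rule image_subsetI)
      fix u assume "u \<in> A"
      then show "bl u \<in> {1..h - 1}" using rng[of u] c by (auto simp: bl_def)
    qed
    show "E \<subseteq> A \<times> A" by (auto simp: layered_def)
    show "bl u \<le> bl v" if "(u, v) \<in> E" for u v
    proof -
      have "s u \<le> s v" using that by (auto simp: layered_def)
      then show ?thesis by (auto simp: bl_def)
    qed
    show "finite S" "card A + (h - 1) \<le> card S + 1" using S c by auto
    fix j and T :: "nat set" assume T: "finite T" "card T = card {u \<in> A. bl u = j}"
    show "\<exists>g. bij_betw g {u \<in> A. bl u = j} T \<and>
        (\<forall>(u, v)\<in>E. u \<noteq> v \<longrightarrow> bl u = j \<longrightarrow> bl v = j \<longrightarrow> g u \<lless> g v)"
    proof (cases "j = c")
      case True
      have eq: "{u \<in> A. bl u = j} = {u \<in> A. s u \<in> {c, Suc c}}" using blc True by blast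
      have T2: "card T = card {u \<in> A. s u \<in> {c, Suc c}}" using T(2) unfolding eq .
      obtain g where g: "bij_betw g {u \<in> A. s u \<in> {c, Suc c}} T"
          and gE: "\<forall>(u, v)\<in>E. u \<noteq> v \<longrightarrow> s u \<in> {c, Suc c} \<longrightarrow> s v \<in> {c, Suc c} \<longrightarrow> g u \<lless> g v"
        using merged_levels_embedding[OF T(1) T2 c_def] by (elim exE conjE) (rule that)
      have "g u \<lless> g v" if uv: "(u, v) \<in> E" "u \<noteq> v" "bl u = j" "bl v = j" for u v
      proof -
        have "u \<in> A" "v \<in> A" using uv(1) by (auto simp: layered_def)
        then have "s u \<in> {c, Suc c}" "s v \<in> {c, Suc c}" using blc uv(3,4) True by blast+
        then show ?thesis using bspec[OF gE uv(1)] uv(2) by blast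
      qed
      then show ?thesis using g unfolding eq by (intro exI[of _ g] conjI) auto
    next
      case False
      have "finite {u \<in> A. bl u = j}" using finA by simp
      then obtain g where g: "bij_betw g {u \<in> A. bl u = j} T"
        using T by (metis finite_same_card_bij)
      have "s u \<noteq> s v" if "(u, v) \<in> E" "u \<noteq> v" for u v using that by (auto simp: layered_def)
      then have "False" if "(u, v) \<in> E" "u \<noteq> v" "bl u = j" "bl v = j" for u v
        using that blj[of u v] False by simp
      then have "\<forall>(u, v)\<in>E. u \<noteq> v \<longrightarrow> bl u = j \<longrightarrow> bl v = j \<longrightarrow> g u \<lless> g v"
        by (intro ballI) auto
      then show ?thesis using g by (intro exI[of _ g] conjI)
    qed
  qed
qed

end

lemma trancl_subset_trans: "r \<subseteq> q \<Longrightarrow> trans q \<Longrightarrow> r\<^sup>+ \<subseteq> q"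
  by (metis trancl_id trancl_mono subsetI)

lemma layered_insert:
  assumes "x \<notin> A"
  shows "layered (insert x A) (rk(x := i)) = layered A rk \<union> {(x, x)} \<union>
    {x} \<times> {u \<in> A. i < rk u} \<union> {u \<in> A. rk u < i} \<times> {x}" (is "?l = ?r")
proof (rule set_eqI)
  fix z :: "'a \<times> 'a"
  obtain u v where z: "z = (u, v)" by (cases z)
  show "z \<in> ?l \<longleftrightarrow> z \<in> ?r"
    unfolding z using assms by (cases "u = x"; cases "v = x") (auto simp: layered_def)
qed

text \<open>
  The closure recovers the relations of \<open>x\<close> to levels further down through a third element \<open>w\<close> of the level
  below, which is where the condition that this level has at least three elements enters.
\<close>

lemma Lambda_closure:
  assumes A: "rk ` A = {1..h}" and x: "x \<notin> A" and i: "2 \<le> i"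
    and ab: "a \<in> A" "b \<in> A" "rk a = i - 1" "rk b = i - 1"
    and w: "w \<in> A" "rk w = i - 1" "w \<notin> {a, b}"
  shows "(layered A rk \<union> {(x, x)} \<union> {x} \<times> {u \<in> A. rk u = i + 1} \<union>
      ({u \<in> A. rk u = i - 1} - {a, b}) \<times> {x})\<^sup>+ =
    layered (insert x A) (rk(x := i)) - {a, b} \<times> {x}" (is "?g\<^sup>+ = ?E")
proof
  have "?g \<subseteq> ?E" unfolding layered_insert[OF x] using x ab i by (auto simp: layered_def)
  moreover have "trans ?E"
    by (rule trans_layered_minus) (use x ab i in auto)
  ultimately show "?g\<^sup>+ \<subseteq> ?E" by (rule trancl_subset_trans)
  show "?E \<subseteq> ?g\<^sup>+"
  proof (rule subrelI)
    fix u v assume uv: "(u, v) \<in> ?E"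
    then consider "u \<in> A" "v \<in> A" | "u = x" "v = x" | "u = x" "v \<in> A" "i < rk v"
      | "u \<in> A" "v = x" "rk u < i" "u \<notin> {a, b}"
      using x unfolding layered_insert[OF x] by (auto simp: layered_def)
    then show "(u, v) \<in> ?g\<^sup>+"
    proof cases
      case 1
      then have "(u, v) \<in> ?g" using uv x unfolding layered_insert[OF x] by auto
      then show ?thesis by auto
    next
      case 2
      then show ?thesis by auto
    next
      case 3
      have "rk v \<in> {1..h}" using A 3(2) by blast
      then have "i + 1 \<in> rk ` A" using A 3(3) by simp
      then obtain z where z: "z \<in> A" "rk z = i + 1" by (metis imageE)
      have "(x, z) \<in> ?g" using z by auto
      moreover have "z = v \<or> (z, v) \<in> ?g \<or> rk v = i + 1" using z 3 by (auto simp: layered_def)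
      moreover have "rk v = i + 1 \<Longrightarrow> (x, v) \<in> ?g" using 3 by auto
      ultimately show ?thesis using 3 by (meson r_into_trancl trancl_into_trancl)
    next
      case 4
      have "(w, x) \<in> ?g" using w by auto
      moreover have "(u, w) \<in> ?g \<or> rk u = i - 1" using w 4 by (auto simp: layered_def)
      moreover have "rk u = i - 1 \<Longrightarrow> (u, x) \<in> ?g" using 4 by auto
      ultimately show ?thesis using 4 by (meson r_into_trancl trancl_into_trancl)
    qed
  qed
qed

lemma V_closure:
  assumes A: "rk ` A = {1..h}" and x: "x \<notin> A"
    and ab: "a \<in> A" "b \<in> A" "rk a = i + 1" "rk b = i + 1"
    and w: "w \<in> A" "rk w = i + 1" "w \<notin> {a, b}"
  shows "(layered A rk \<union> {(x, x)} \<union> {u \<in> A. rk u = i - 1} \<times> {x} \<union>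
      {x} \<times> ({u \<in> A. rk u = i + 1} - {a, b}))\<^sup>+ =
    layered (insert x A) (rk(x := i)) - {x} \<times> {a, b}" (is "?g\<^sup>+ = ?E")
proof
  have pos: "1 \<le> rk u" if "u \<in> A" for u using A that by force
  have "?g \<subseteq> ?E"
  proof (rule subrelI)
    fix u v assume uv: "(u, v) \<in> ?g"
    have "rk u < i" if "u \<in> A" "rk u = i - 1" using pos[OF that(1)] that by simp
    then show "(u, v) \<in> ?E" using uv x ab unfolding layered_insert[OF x] by (auto simp: layered_def)
  qed
  moreover have "trans ?E"
    by (rule trans_layered_minus) (use x ab in auto)
  ultimately show "?g\<^sup>+ \<subseteq> ?E" by (rule trancl_subset_trans)
  show "?E \<subseteq> ?g\<^sup>+"
  proof (rule subrelI)
    fix u v assume uv: "(u, v) \<in> ?E"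
    then consider "u \<in> A" "v \<in> A" | "u = x" "v = x" | "u = x" "v \<in> A" "i < rk v" "v \<notin> {a, b}"
      | "u \<in> A" "v = x" "rk u < i"
      using x unfolding layered_insert[OF x] by (auto simp: layered_def)
    then show "(u, v) \<in> ?g\<^sup>+"
    proof cases
      case 1
      then have "(u, v) \<in> ?g" using uv x unfolding layered_insert[OF x] by auto
      then show ?thesis by auto
    next
      case 2
      then show ?thesis by auto
    next
      case 3
      have "(x, w) \<in> ?g" using w by auto
      moreover have "(w, v) \<in> ?g \<or> rk v = i + 1" using w 3 by (auto simp: layered_def)
      moreover have "rk v = i + 1 \<Longrightarrow> (x, v) \<in> ?g" using 3 by auto
      ultimately show ?thesis using 3 by (meson r_into_trancl trancl_into_trancl)
    next
      case 4
      have "1 \<le> i - 1" using pos[OF 4(1)] 4(3) by simp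
      moreover have "i + 1 \<le> h" using A ab by force
      ultimately have "i - 1 \<in> rk ` A" using A by simp
      then obtain z where z: "z \<in> A" "rk z = i - 1" by (metis imageE)
      have "(z, x) \<in> ?g" using z by auto
      moreover have "(u, z) \<in> ?g \<or> rk u = i - 1" using z 4 by (auto simp: layered_def)
      moreover have "rk u = i - 1 \<Longrightarrow> (u, x) \<in> ?g" using 4 by auto
      ultimately show ?thesis using 4 by (meson r_into_trancl trancl_into_trancl)
    qed
  qed
qed

lemma extension_cases:
  assumes fin: "finite A" and rkA: "rk ` A = {1..h}" and h: "1 \<le> h"
    and ext: "Lambda_extension (layered A rk) i P' \<or> V_extension (layered A rk) i P'"
  obtains x s a b Q where "x \<notin> A" "extension (insert x A) s h x a b Q"
    "P' = layered (insert x A) s - Q" "layered A rk \<subseteq> P'"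
proof -
  interpret P: ranked_poset "layered A rk" rk h using fin rkA by (rule ranked_layered)
  have lev: "level (layered A rk) j = {u \<in> A. rk u = j}" for j using P.level_eq by simp
  have height: "height (layered A rk) = h" using P.height_eq h by simp
  have third: "\<exists>w. w \<in> A \<and> rk w = j \<and> w \<notin> {a, b}" if "3 \<le> card {u \<in> A. rk u = j}" for j a b
  proof (rule ccontr)
    assume "\<not> ?thesis"
    then have "{u \<in> A. rk u = j} \<subseteq> {a, b}" by blast
    then have "card {u \<in> A. rk u = j} \<le> card {a, b}" by (intro card_mono) auto
    also have "\<dots> \<le> 2" by (simp add: card_insert_if)
    finally show False using that by simp
  qed
  have hit: "\<exists>v\<in>A. rk v = j" if "1 \<le> j" "j \<le> h" for j
    using rkA that by (metis atLeastAtMost_iff imageE)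
  have rng: "1 \<le> rk u \<and> rk u \<le> h" if "u \<in> A" for u using rkA that by force
  have img: "(rk(x := i)) ` insert x A = {1..h}" if "x \<notin> A" "1 \<le> i" "i \<le> h" for x
  proof -
    have "(rk(x := i)) ` insert x A = insert i (rk ` A)" using that by auto
    then show ?thesis using rkA that by auto
  qed
  show thesis using ext
  proof
    assume "Lambda_extension (layered A rk) i P'"
    then obtain x a b where i: "2 \<le> i" "i \<le> h" and c3: "3 \<le> card {u \<in> A. rk u = i - 1}"
      and x: "x \<notin> A" and ab: "a \<in> A" "b \<in> A" "rk a = i - 1" "rk b = i - 1" "a \<noteq> b"
      and P': "P' = (layered A rk \<union> {(x, x)} \<union> {x} \<times> {u \<in> A. rk u = i + 1} \<union>
        ({u \<in> A. rk u = i - 1} - {a, b}) \<times> {x})\<^sup>+"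
      unfolding Lambda_extension_def lev height by auto
    obtain w where w: "w \<in> A" "rk w = i - 1" "w \<notin> {a, b}" using third[OF c3] by blast
    have E: "P' = layered (insert x A) (rk(x := i)) - {a, b} \<times> {x}"
      unfolding P' by (rule Lambda_closure[OF rkA x i(1) ab(1-4) w])
    have sub: "layered A rk \<subseteq> P'" unfolding E layered_insert[OF x] using x by (auto simp: layered_def)
    have "extension (insert x A) (rk(x := i)) h x a b ({a, b} \<times> {x})"
    proof
      show "(rk(x := i)) ` insert x A = {1..h}" using img x i by simp
      show "\<exists>v\<in>insert x A. Suc ((rk(x := i)) v) = (rk(x := i)) u \<and> (v, u) \<notin> {a, b} \<times> {x}"
        if u: "u \<in> insert x A" "1 < (rk(x := i)) u" for u
      proof (cases "u = x")
        case True
        then show ?thesis using w x i by (intro bexI[of _ w]) auto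
      next
        case False
        then have "1 \<le> rk u - 1" "rk u - 1 \<le> h" using u rng[of u] by auto
        then obtain v where "v \<in> A" "rk v = rk u - 1" using hit by blast
        then show ?thesis using False u x by (intro bexI[of _ v]) auto
      qed
      show "{a, b} \<times> {x} = {a, b} \<times> {x} \<and> (rk(x := i)) a = (rk(x := i)) b \<and> (rk(x := i)) x = Suc ((rk(x := i)) a) \<or>
        {a, b} \<times> {x} = {x} \<times> {a, b} \<and> (rk(x := i)) a = (rk(x := i)) b \<and> (rk(x := i)) a = Suc ((rk(x := i)) x)"
        using ab x i by auto
    qed (use fin ab in auto)
    then show thesis using that[OF x _ E sub] by blast
  next
    assume "V_extension (layered A rk) i P'"
    then obtain x a b where i: "1 \<le> i" "i + 1 \<le> h" and c3: "3 \<le> card {u \<in> A. rk u = i + 1}"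
      and x: "x \<notin> A" and ab: "a \<in> A" "b \<in> A" "rk a = i + 1" "rk b = i + 1" "a \<noteq> b"
      and P': "P' = (layered A rk \<union> {(x, x)} \<union> {u \<in> A. rk u = i - 1} \<times> {x} \<union>
        {x} \<times> ({u \<in> A. rk u = i + 1} - {a, b}))\<^sup>+"
      unfolding V_extension_def lev height by auto
    obtain w where w: "w \<in> A" "rk w = i + 1" "w \<notin> {a, b}" using third[OF c3] by blast
    have E: "P' = layered (insert x A) (rk(x := i)) - {x} \<times> {a, b}"
      unfolding P' by (rule V_closure[OF rkA x ab(1-4) w])
    have sub: "layered A rk \<subseteq> P'" unfolding E layered_insert[OF x] using x by (auto simp: layered_def)
    have "extension (insert x A) (rk(x := i)) h x a b ({x} \<times> {a, b})"
    proof
      show "(rk(x := i)) ` insert x A = {1..h}" using img x i by simp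
      show "\<exists>v\<in>insert x A. Suc ((rk(x := i)) v) = (rk(x := i)) u \<and> (v, u) \<notin> {x} \<times> {a, b}"
        if u: "u \<in> insert x A" "1 < (rk(x := i)) u" for u
      proof -
        have "1 \<le> (rk(x := i)) u - 1" "(rk(x := i)) u - 1 \<le> h" using u rng[of u] i by auto
        then obtain v where "v \<in> A" "rk v = (rk(x := i)) u - 1" using hit by blast
        then show ?thesis using u x by (intro bexI[of _ v]) auto
      qed
      show "{x} \<times> {a, b} = {a, b} \<times> {x} \<and> (rk(x := i)) a = (rk(x := i)) b \<and> (rk(x := i)) x = Suc ((rk(x := i)) a) \<or>
        {x} \<times> {a, b} = {x} \<times> {a, b} \<and> (rk(x := i)) a = (rk(x := i)) b \<and> (rk(x := i)) a = Suc ((rk(x := i)) x)"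
        using ab x i by auto
    qed (use fin ab in auto)
    then show thesis using that[OF x _ E sub] by blast
  qed
qed

section \<open>Averaging over the double chains of a Boolean lattice\<close>

definition dc_set :: "nat \<Rightarrow> nat set" where
  "dc_set u = (if even u then {1..u div 2} else insert (u div 2 + 1) {1..<u div 2})"

lemma card_dc_set: "2 \<le> u \<Longrightarrow> card (dc_set u) = u div 2"
  by (auto simp: dc_set_def)

lemma dc_set_subset: "u \<in> {2..<2 * n} \<Longrightarrow> dc_set u \<subseteq> {1..n}"
  by (auto simp: dc_set_def)

lemma dc_set_mono:
  assumes "u \<lless> v"
  shows "dc_set u \<subseteq> dc_set v"
proof -
  have "\<exists>i. w = 2 * i \<or> w = Suc (2 * i)" for w :: nat by presburger
  then obtain i j where "u = 2 * i \<or> u = Suc (2 * i)" "v = 2 * j \<or> v = Suc (2 * j)" by blast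
  then show ?thesis using assms by (auto simp: dc_less_def dc_set_def)
qed

text \<open>
  The codes \<open>0\<close> and \<open>1\<close> are left out: there is no \<open>B\<^sub>0\<close>, and its code denotes the same set as \<open>A\<^sub>1\<close>.
\<close>

lemma inj_on_dc_set: "inj_on dc_set {2..}"
proof (rule inj_onI)
  fix u v :: nat assume uv: "u \<in> {2..}" "v \<in> {2..}" and eq: "dc_set u = dc_set v"
  have half: "u div 2 = v div 2" using uv card_dc_set[of u] card_dc_set[of v] eq by simp
  have "even w \<longleftrightarrow> w div 2 + 1 \<notin> dc_set w" for w :: nat by (auto simp: dc_set_def)
  then have "even u \<longleftrightarrow> even v" using half eq by metis
  then show "u = v" using half by presburger
qed

context extension
begin

lemma double_chain_contains:
  assumes \<pi>: "\<pi> permutes {1..n}"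
    and many: "card A + h \<le> card {u \<in> {2..<2 * n}. \<pi> ` dc_set u \<in> F} + 2"
  shows "contains_poset (inclusion_order F) E"
proof -
  let ?S = "{u \<in> {2..<2 * n}. \<pi> ` dc_set u \<in> F}"
  have "finite ?S" by simp
  from extension_embedding[OF this many] obtain g where inj: "inj_on g A" and gS: "g ` A \<subseteq> ?S"
    and mono: "\<forall>(u, v)\<in>E. u \<noteq> v \<longrightarrow> g u \<lless> g v"
    by (elim exE conjE) (rule that)
  let ?f = "\<lambda>u. \<pi> ` dc_set (g u)"
  have "inj_on dc_set (g ` A)" using gS by (intro inj_on_subset[OF inj_on_dc_set]) auto
  then have "inj_on (\<lambda>u. dc_set (g u)) A" using inj by (simp add: comp_inj_on[unfolded comp_def])
  then have injf: "inj_on ?f A"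
    using permutes_inj[OF \<pi>] by (auto simp: inj_on_def inj_image_eq_iff)
  have fF: "?f u \<in> F" if "u \<in> A" for u using gS that by auto
  have "Field (inclusion_order F) = F" by (auto simp: Field_def inclusion_order_def)
  moreover have "(?f u, ?f v) \<in> inclusion_order F" if uv: "(u, v) \<in> E" for u v
  proof -
    have "u \<in> A" "v \<in> A" using uv by (auto simp: layered_def)
    moreover have "dc_set (g u) \<subseteq> dc_set (g v)"
      using bspec[OF mono uv] dc_set_mono by (cases "u = v") auto
    ultimately show ?thesis using fF by (auto simp: inclusion_order_def)
  qed
  ultimately show ?thesis unfolding contains_poset_def Field_E
    using injf fF by (intro exI[of _ ?f]) auto
qed

end

lemma exists_permutation_image:
  assumes "finite T" "X \<subseteq> T" "Y \<subseteq> T" "card X = card Y"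
  shows "\<exists>\<sigma>. \<sigma> permutes T \<and> \<sigma> ` X = Y"
proof -
  obtain f where f: "bij_betw f T T" "f ` X = Y"
    using bij_betw_onto_subset[of T T X Y] assms by auto
  let ?s = "\<lambda>u. if u \<in> T then f u else u"
  have "bij_betw ?s T T" using f(1) by (simp cong: bij_betw_cong)
  then have "?s permutes T" by (rule bij_imp_permutes) simp
  moreover have "?s ` X = Y" using f(2) assms(2) by (auto simp: subset_iff)
  ultimately show ?thesis by blast
qed

text \<open>
  Composition with a permutation moving one \<open>k\<close>-subset to another shows that the image of \<open>C\<close> under a random
  permutation is uniformly distributed over all \<open>k\<close>-subsets.
\<close>

lemma card_permutations_image:
  assumes T: "finite T" "card T = n" and C: "C \<subseteq> T" "card C = k" and X: "X \<subseteq> T" "card X = k"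
  shows "card {\<pi>. \<pi> permutes T \<and> \<pi> ` C = X} * (n choose k) = fact n"
proof -
  define Perms where "Perms = {\<pi>. \<pi> permutes T}"
  define L where "L = {Y. Y \<subseteq> T \<and> card Y = k}"
  have fin: "finite Perms" "finite L"
    using T finite_permutations by (auto simp: Perms_def L_def)
  have same: "card {\<pi> \<in> Perms. \<pi> ` C = Y} \<le> card {\<pi> \<in> Perms. \<pi> ` C = Z}" if YZ: "Y \<in> L" "Z \<in> L" for Y Z
  proof -
    obtain \<sigma> where \<sigma>: "\<sigma> permutes T" "\<sigma> ` Y = Z"
      using exists_permutation_image[OF T(1), of Y Z] YZ by (auto simp: L_def)
    have "inj_on (\<lambda>\<pi>. \<sigma> \<circ> \<pi>) {\<pi> \<in> Perms. \<pi> ` C = Y}"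
    proof (rule inj_onI)
      fix \<pi> \<pi>' assume eq: "\<sigma> \<circ> \<pi> = \<sigma> \<circ> \<pi>'"
      have "\<pi> u = \<pi>' u" for u
        using fun_cong[OF eq, of u] by (simp add: inj_eq[OF permutes_inj[OF \<sigma>(1)]])
      then show "\<pi> = \<pi>'" by (rule ext)
    qed
    moreover have "(\<lambda>\<pi>. \<sigma> \<circ> \<pi>) ` {\<pi> \<in> Perms. \<pi> ` C = Y} \<subseteq> {\<pi> \<in> Perms. \<pi> ` C = Z}"
    proof (rule image_subsetI)
      fix \<pi> assume "\<pi> \<in> {\<pi> \<in> Perms. \<pi> ` C = Y}"
      then have "\<pi> permutes T" "\<pi> ` C = Y" by (auto simp: Perms_def)
      moreover from this have "(\<sigma> \<circ> \<pi>) ` C = Z" using \<sigma>(2) by (metis image_comp)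
      ultimately show "\<sigma> \<circ> \<pi> \<in> {\<pi> \<in> Perms. \<pi> ` C = Z}"
        using permutes_compose[OF _ \<sigma>(1)] by (simp add: Perms_def)
    qed
    ultimately show ?thesis using fin by (intro card_inj_on_le) auto
  qed
  have "X \<in> L" using X by (simp add: L_def)
  then have const: "card {\<pi> \<in> Perms. \<pi> ` C = Y} = card {\<pi> \<in> Perms. \<pi> ` C = X}" if "Y \<in> L" for Y
    using same that by (simp add: le_antisym)
  have "(\<lambda>\<pi>. \<pi> ` C) ` Perms \<subseteq> L"
  proof (rule image_subsetI)
    fix \<pi> assume "\<pi> \<in> Perms"
    then have \<pi>: "\<pi> permutes T" by (simp add: Perms_def)
    have "card (\<pi> ` C) = k" using permutes_inj[OF \<pi>] C(2) by (metis card_image inj_on_subset subset_UNIV)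
    moreover have "\<pi> ` C \<subseteq> T" using permutes_image[OF \<pi>] C(1) by blast
    ultimately show "\<pi> ` C \<in> L" by (simp add: L_def)
  qed
  then have "(\<Sum>Y\<in>L. \<Sum>\<pi> | \<pi> \<in> Perms \<and> \<pi> ` C = Y. 1) = (\<Sum>\<pi>\<in>Perms. 1::nat)"
    using fin by (intro sum.group)
  then have "(\<Sum>Y\<in>L. card {\<pi> \<in> Perms. \<pi> ` C = Y}) = card Perms" by simp
  also have "card Perms = fact n" using T by (simp add: Perms_def card_permutations)
  also have "(\<Sum>Y\<in>L. card {\<pi> \<in> Perms. \<pi> ` C = Y}) = card L * card {\<pi> \<in> Perms. \<pi> ` C = X}"
    using const by simp
  also have "card L = n choose k" using n_subsets[OF T(1), of k] T(2) by (simp add: L_def)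
  finally show ?thesis by (simp add: Perms_def mult.commute)
qed

text \<open>
  Double counting of the pairs of a permutation and a member of \<open>F\<close> on the permuted double chain. A set of
  size \<open>k\<close> with \<open>0 < k < n\<close> is hit by two positions of the double chain, each with probability
  \<open>1 / (n choose k)\<close>, hence at least \<open>1 / (n choose (n div 2))\<close>. The summand \<open>2\<close> accounts for the sets
  \<open>{}\<close> and \<open>{1..n}\<close>.
\<close>

lemma card_family_le:
  assumes F: "F \<subseteq> Pow {1..n}"
    and few: "\<And>\<pi>. \<pi> permutes {1..n} \<Longrightarrow> card {u \<in> {2..<2 * n}. \<pi> ` dc_set u \<in> F} \<le> 2 * m"
  shows "card F \<le> m * (n choose (n div 2)) + 2"
proof -
  define D where "D = {2..<2 * n}"
  define M where "M = n choose (n div 2)"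
  define Perms where "Perms = {\<pi>. \<pi> permutes {1..n}}"
  define F' where "F' = F - {{}, {1..n}}"
  have fin: "finite F" "finite Perms" "finite D" "finite F'"
    using F finite_permutations[of "{1..n}"] finite_subset[OF F] by (auto simp: Perms_def D_def F'_def)
  have M: "n choose k \<le> M" for k unfolding M_def by (rule binomial_maximum)
  have F'sub: "X \<subseteq> {1..n}" "X \<in> F" if "X \<in> F'" for X using that F by (auto simp: F'_def)
  have F'card: "card X \<in> {1..<n}" if X: "X \<in> F'" for X
  proof -
    have "X \<subset> {1..n}" "X \<noteq> {}" using X F'sub[OF X] by (auto simp: F'_def)
    moreover from this have "finite X" using finite_subset[of X "{1..n}"] by auto
    ultimately show ?thesis using psubset_card_mono[of "{1..n}" X] by (auto simp: Suc_le_eq card_gt_0_iff)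
  qed
  have fibre: "fact n * card {X \<in> F'. card X = u div 2} \<le> M * card {\<pi> \<in> Perms. \<pi> ` dc_set u \<in> F}"
    if u: "u \<in> D" for u
  proof -
    let ?X = "{X \<in> F'. card X = u div 2}"
    let ?N = "\<lambda>X. {\<pi> \<in> Perms. \<pi> ` dc_set u = X}"
    have one: "fact n \<le> M * card (?N X)" if X: "X \<in> ?X" for X
    proof -
      have "card (?N X) * (n choose (u div 2)) = fact n"
        using card_permutations_image[of "{1..n}" n "dc_set u" "u div 2" X] X u
          dc_set_subset card_dc_set F'sub by (auto simp: Perms_def D_def)
      then show ?thesis using mult_le_mono2[OF M] by (metis mult.commute)
    qed
    have "fact n * card ?X = (\<Sum>X\<in>?X. fact n)" by simp
    also have "\<dots> \<le> (\<Sum>X\<in>?X. M * card (?N X))" using one by (rule sum_mono)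
    also have "\<dots> = M * (\<Sum>X\<in>?X. card (?N X))" by (simp add: sum_distrib_left)
    also have "(\<Sum>X\<in>?X. card (?N X)) = card (\<Union>X\<in>?X. ?N X)"
      using fin by (intro card_UN_disjoint[symmetric]) auto
    also have "M * \<dots> \<le> M * card {\<pi> \<in> Perms. \<pi> ` dc_set u \<in> F}"
      using fin F'sub by (intro mult_le_mono2 card_mono) auto
    finally show ?thesis .
  qed
  have two: "card {u \<in> D. card X = u div 2} = 2" if X: "X \<in> F'" for X
  proof -
    have "{u \<in> D. card X = u div 2} = {2 * card X, 2 * card X + 1}"
      using F'card[OF X] by (auto simp: D_def)
    then show ?thesis by simp
  qed
  have "fact n * (2 * card F') = fact n * (\<Sum>u\<in>D. card {X \<in> F'. card X = u div 2})"
    using sum_multicount[of D F' "\<lambda>u X. card X = u div 2" 2] fin two by simp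
  also have "\<dots> = (\<Sum>u\<in>D. fact n * card {X \<in> F'. card X = u div 2})" by (rule sum_distrib_left)
  also have "\<dots> \<le> (\<Sum>u\<in>D. M * card {\<pi> \<in> Perms. \<pi> ` dc_set u \<in> F})" using fibre by (rule sum_mono)
  also have "\<dots> = M * (\<Sum>u\<in>D. card {\<pi> \<in> Perms. \<pi> ` dc_set u \<in> F})" by (rule sum_distrib_left[symmetric])
  also have "(\<Sum>u\<in>D. card {\<pi> \<in> Perms. \<pi> ` dc_set u \<in> F}) = (\<Sum>\<pi>\<in>Perms. card {u \<in> D. \<pi> ` dc_set u \<in> F})"
    using fin by (intro sum_multicount_gen) auto
  also have "M * \<dots> \<le> M * (\<Sum>\<pi>\<in>Perms. 2 * m)"
    using few by (intro mult_le_mono2 sum_mono) (auto simp: Perms_def D_def)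
  also have "\<dots> = fact n * (2 * (m * M))" by (simp add: Perms_def card_permutations)
  finally have "card F' \<le> m * M" by simp
  moreover have "card F \<le> card F' + card {{}, {1..n}}"
    unfolding F'_def using diff_card_le_card_Diff[of "{{}, {1..n}}" F] by simp
  moreover have "card {{}, {1..n}} \<le> 2" by (simp add: card_insert_if)
  ultimately show ?thesis by (simp add: M_def)
qed

section \<open>Consecutive levels and the asymptotics of La\<close>

lemma poset_free_levels:
  assumes "spread_at_least p m"
  shows "poset_free p (\<Union>i\<in>{k..<k + m}. boolean_level n i)"
  unfolding poset_free_def
proof
  let ?F = "\<Union>i\<in>{k..<k + m}. boolean_level n i"
  assume "contains_poset (inclusion_order ?F) p"
  then obtain f where inj: "inj_on f (Field p)" and fF: "f ` Field p \<subseteq> Field (inclusion_order ?F)"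
    and mono: "\<forall>(a, b)\<in>p. (f a, f b) \<in> inclusion_order ?F"
    unfolding contains_poset_def by blast
  have "Field (inclusion_order ?F) = ?F" by (auto simp: Field_def inclusion_order_def)
  then have mem: "f x \<in> ?F" if "x \<in> Field p" for x using fF that by blast
  have rng: "f x \<subseteq> {1..n} \<and> k \<le> card (f x) \<and> card (f x) < k + m" if "x \<in> Field p" for x
    using mem[OF that] by (auto simp: boolean_level_def)
  have "boolean_embedding p f"
    unfolding boolean_embedding_def
  proof (intro conjI ballI)
    show "finite (f x)" if "x \<in> Field p" for x using rng[OF that] finite_subset by blast
    show "case z of (x, y) \<Rightarrow> f x \<subseteq> f y" if "z \<in> p" for z
      using bspec[OF mono that] by (auto simp: inclusion_order_def)
  qed (rule inj)
  then obtain x y where "x \<in> Field p" "y \<in> Field p" "card (f x) + m \<le> card (f y)"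
    using assms unfolding spread_at_least_def by blast
  then show False using rng[of x] rng[of y] by linarith
qed

lemma poset_free_mono:
  assumes "poset_free p F" "p \<subseteq> q"
  shows "poset_free q F"
proof -
  have "contains_poset (inclusion_order F) p" if c: "contains_poset (inclusion_order F) q"
  proof -
    obtain f where "inj_on f (Field q)" "f ` Field q \<subseteq> Field (inclusion_order F)"
        and mono: "\<forall>(a, b)\<in>q. (f a, f b) \<in> inclusion_order F"
      using c unfolding contains_poset_def by (elim exE conjE) (rule that)
    moreover have "Field p \<subseteq> Field q" using assms(2) by (rule mono_Field)
    moreover have "\<forall>(a, b)\<in>p. (f a, f b) \<in> inclusion_order F"
      using mono assms(2) by blast
    ultimately show ?thesis unfolding contains_poset_def
      by (intro exI[of _ f] conjI) (auto intro: inj_on_subset)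
  qed
  then show ?thesis using assms(1) unfolding poset_free_def by blast
qed

lemma card_levels: "card (\<Union>i\<in>{k..<k + m}. boolean_level n i) = (\<Sum>j<m. n choose (k + j))"
proof -
  have "card (\<Union>i\<in>{k..<k + m}. boolean_level n i) = (\<Sum>i\<in>{k..<k + m}. card (boolean_level n i))"
    by (rule card_UN_disjoint) (auto simp: boolean_level_def)
  also have "\<dots> = (\<Sum>i\<in>{k..<k + m}. n choose i)"
    using n_subsets[of "{1..n}"] by (simp add: boolean_level_def)
  also have "\<dots> = (\<Sum>j<m. n choose (k + j))"
    using sum.shift_bounds_nat_ivl[of "\<lambda>i. n choose i" 0 k m]
    by (simp add: add.commute atLeast0LessThan)
  finally show ?thesis .
qed

text \<open>
  Any fixed number of levels near the middle have asymptotically the same size, so \<open>m\<close> of them contain about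
  \<open>m\<close> times as many sets as the largest one.
\<close>

lemma central_binomial_ratio:
  "(\<lambda>n. real (n choose (n div 2 + j)) / real (n choose (n div 2))) \<longlonglongrightarrow> 1"
proof (induction j)
  case 0
  have "n choose (n div 2) \<noteq> 0" for n by (simp add: binomial_eq_0_iff)
  then show ?case by simp
next
  case (Suc j)
  define q where "q n = real (n - (n div 2 + j)) / real (n div 2 + j + 1)" for n
  have "q \<longlonglongrightarrow> 1"
  proof (rule tendsto_0_le[THEN LIM_zero_cancel])
    show "(\<lambda>n. real (4 * (j + 1)) / real n) \<longlonglongrightarrow> 0" by (rule lim_const_over_n)
    show "\<forall>\<^sub>F n in sequentially. norm (q n - 1) \<le> norm (real (4 * (j + 1)) / real n) * 1"
      using eventually_ge_at_top[of "2 * j + 2"]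
    proof eventually_elim
      case (elim n)
      define k where "k = n div 2 + j"
      have k: "k \<le> n" "n \<le> 2 * (k + 1)" "n \<le> 2 * k + 1" "2 * k \<le> n + 2 * j" using elim by (auto simp: k_def)
      have "q n - 1 = (real n - 2 * real k - 1) / (real k + 1)"
        unfolding q_def k_def[symmetric] using k by (simp add: of_nat_diff field_simps)
      also have "norm \<dots> = \<bar>real n - 2 * real k - 1\<bar> / (real k + 1)" by simp
      also have "\<dots> \<le> (2 * real j + 1) / (real k + 1)"
        using k by (intro divide_right_mono) auto
      also have "\<dots> \<le> (2 * real j + 2) / (real n / 2)"
        using k elim by (intro frac_le) auto
      also have "\<dots> = real (4 * (j + 1)) / real n" by (simp add: field_simps)
      finally show ?case by simp
    qed
  qed
  have step: "real (n choose (n div 2 + Suc j)) / real (n choose (n div 2)) =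
      real (n choose (n div 2 + j)) / real (n choose (n div 2)) * q n" for n
  proof -
    let ?k = "n div 2 + j"
    have "Suc ?k * (n choose Suc ?k) = (n - ?k) * (n choose ?k)"
      by (metis binomial_absorb_comp binomial_absorption)
    then have "real (Suc ?k) * real (n choose Suc ?k) = real (n - ?k) * real (n choose ?k)"
      by (metis of_nat_mult)
    then have "real (n choose Suc ?k) = real (n choose ?k) * q n"
      unfolding q_def by (simp add: field_simps)
    then show ?thesis by simp
  qed
  have "(\<lambda>n. real (n choose (n div 2 + j)) / real (n choose (n div 2)) * q n) \<longlonglongrightarrow> 1 * 1"
    using Suc.IH \<open>q \<longlonglongrightarrow> 1\<close> by (rule tendsto_mult)
  then show ?case unfolding step by simp
qed

theorem mainTheorem4:
  fixes P P' :: "'a rel"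
  assumes "burcsi_nagy P"
    and "\<exists>i. Lambda_extension P i P' \<or> V_extension P i P'"
  shows "real (poset_e P') =
           (real (card (Field P')) + real (height P') - real (aux_alpha P') - 2) / 2 \<and>
         (\<lambda>n. real (La n P') / real (n choose (n div 2))) \<longlonglongrightarrow> real (poset_e P')"
proof -
  obtain rk h m where fin: "finite (Field P)" and rk: "rk ` Field P = {1..h}"
    and P: "P = layered (Field P) rk" and m: "card (Field P) + h = 2 * m + 2"
    and spread: "spread_at_least P m"
    using burcsi_nagy_layered[OF assms(1)] by blast
  define A where "A = Field P"
  note fin = fin[folded A_def] and rk = rk[folded A_def] and m = m[folded A_def]
  have PA: "P = layered A rk" using P by (simp add: A_def)
  have h: "1 \<le> h"
  proof (rule ccontr)
    assume "\<not> 1 \<le> h"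
    then have "A = {}" using rk by auto
    then show False using m \<open>\<not> 1 \<le> h\<close> by simp
  qed
  obtain i where "Lambda_extension (layered A rk) i P' \<or> V_extension (layered A rk) i P'"
    using assms(2) PA by auto
  then obtain x s a b Q where xA: "x \<notin> A" and ext: "extension (insert x A) s h x a b Q"
    and P': "P' = layered (insert x A) s - Q" and sub: "layered A rk \<subseteq> P'"
    by (rule extension_cases[OF fin rk h])
  interpret extension "insert x A" s h x a b Q by (rule ext)
  have F': "Field P' = insert x A" unfolding P' by (rule Field_E)
  have size: "card (insert x A) + h = 2 * m + 3" using m xA fin by simp

  have upper: "card F \<le> m * (n choose (n div 2)) + 2"
    if F: "F \<subseteq> Pow {1..n}" "poset_free P' F" for n F
  proof (rule card_family_le[OF F(1)])
    fix \<pi> assume "\<pi> permutes {1..n}"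
    then show "card {u \<in> {2..<2 * n}. \<pi> ` dc_set u \<in> F} \<le> 2 * m"
      using double_chain_contains[of \<pi> n F] F(2) size unfolding poset_free_def P' by fastforce
  qed
  have free: "poset_free P' (\<Union>i\<in>{k..<k + m}. boolean_level n i)" for n k
    using poset_free_mono[OF poset_free_levels[OF spread]] sub PA by blast

  have e: "poset_e P' = m"
    unfolding poset_e_def
  proof (rule Max_eqI)
    let ?M = "{m'. \<forall>n k. k + m' \<le> n + 1 \<longrightarrow> poset_free P' (\<Union>i\<in>{k..<k + m'}. boolean_level n i)}"
    show le: "m' \<le> m" if "m' \<in> ?M" for m'
    proof (rule ccontr)
      assume gt: "\<not> m' \<le> m"
      \<comment> \<open>The levels strictly between the empty and the full set contain the whole double chain.\<close>
      let ?n = "m' + 1"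
      let ?F = "\<Union>i\<in>{1..<1 + m'}. boolean_level ?n i"
      have "1 + m' \<le> ?n + 1" by simp
      then have free': "poset_free P' ?F" using that unfolding mem_Collect_eq by blast
      have "dc_set u \<in> ?F" if "u \<in> {2..<2 * ?n}" for u
        using that dc_set_subset[OF that] card_dc_set[of u] by (auto simp: boolean_level_def)
      then have "{u \<in> {2..<2 * ?n}. id ` dc_set u \<in> ?F} = {2..<2 * ?n}" by auto
      then have "card (insert x A) + h \<le> card {u \<in> {2..<2 * ?n}. id ` dc_set u \<in> ?F} + 2"
        using gt size by simp
      then show False
        using double_chain_contains[OF permutes_id] free' unfolding poset_free_def P' by blast
    qed
    show "finite ?M" using le by (meson finite_nat_set_iff_bounded_le)
    show "m \<in> ?M" using free by blast
  qed

  have La_upper: "La n P' \<le> m * (n choose (n div 2)) + 2"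
    and La_lower: "(\<Sum>j<m. n choose (n div 2 + j)) \<le> La n P'" for n
  proof -
    let ?C = "{card F |F. F \<subseteq> Pow {1..n} \<and> poset_free P' F}"
    have "?C \<subseteq> card ` Pow (Pow {1..n})" by auto
    then have finC: "finite ?C" by (rule finite_subset) simp
    let ?F = "\<Union>i\<in>{n div 2..<n div 2 + m}. boolean_level n i"
    have "?F \<subseteq> Pow {1..n}" by (auto simp: boolean_level_def)
    then have "card ?F \<in> ?C" using free by blast
    then have mid: "(\<Sum>j<m. n choose (n div 2 + j)) \<in> ?C" unfolding card_levels .
    show "(\<Sum>j<m. n choose (n div 2 + j)) \<le> La n P'"
      unfolding La_def by (rule Max_ge[OF finC mid])
    have "La n P' \<in> ?C" unfolding La_def using finC mid by (intro Max_in) auto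
    then show "La n P' \<le> m * (n choose (n div 2)) + 2" using upper by auto
  qed
  have "(\<lambda>n. real (La n P') / real (n choose (n div 2))) \<longlonglongrightarrow> real m"
  proof (rule tendsto_sandwich)
    let ?M = "\<lambda>n. n choose (n div 2)"
    have pos: "0 < ?M n" for n by (simp add: zero_less_binomial)
    show "(\<lambda>n. \<Sum>j<m. real (n choose (n div 2 + j)) / real (?M n)) \<longlonglongrightarrow> real m"
      using tendsto_sum[of "{..<m}", OF central_binomial_ratio] by simp
    show "\<forall>\<^sub>F n in sequentially. (\<Sum>j<m. real (n choose (n div 2 + j)) / real (?M n))
        \<le> real (La n P') / real (?M n)"
    proof (intro always_eventually allI)
      fix n
      have "(\<Sum>j<m. real (n choose (n div 2 + j))) \<le> real (La n P')"
        using La_lower[of n] by (metis of_nat_le_iff of_nat_sum)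
      then show "(\<Sum>j<m. real (n choose (n div 2 + j)) / real (?M n)) \<le> real (La n P') / real (?M n)"
        by (simp add: sum_divide_distrib[symmetric] divide_right_mono)
    qed
    show "(\<lambda>n. real m + 2 / real n) \<longlonglongrightarrow> real m"
      using tendsto_add[OF tendsto_const lim_const_over_n[of 2], of "real m"] by simp
    show "\<forall>\<^sub>F n in sequentially. real (La n P') / real (?M n) \<le> real m + 2 / real n"
      using eventually_gt_at_top[of 0]
    proof eventually_elim
      case (elim n)
      have "n \<le> ?M n" using binomial_maximum[of n 1] by simp
      then have "2 / real (?M n) \<le> 2 / real n" using elim by (intro divide_left_mono) auto
      moreover have "real (La n P') \<le> real m * real (?M n) + 2"
        using La_upper[of n] by (metis of_nat_add of_nat_le_iff of_nat_mult of_nat_numeral)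
      then have "real (La n P') / real (?M n) \<le> real m + 2 / real (?M n)"
        using pos[of n] by (simp add: field_simps)
      ultimately show ?case by linarith
    qed
  qed
  moreover have "height P' = h" unfolding P' using h by (rule height_eq)
  moreover have "aux_alpha P' = 1" unfolding P' by (rule aux_alpha_E)
  moreover have "real (card (insert x A)) + real h = 2 * real m + 3" using size by linarith
  ultimately show ?thesis unfolding e F' by simp
qed

end
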